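(* Let $F_1$ and $F_2$ be two fields containing an algebraically closed field $K$. Let $A$ and $B$ be two $K$-algebras of the same (possibly infinite) dimension $\omega$. Suppose that the cardinal of $K$ is strictly greater than $\omega$. Then $A_{F_1}$ and $B_{F_1}$ are isomorphic as $F_1$-algebras if and only if $A_{F_2}$ and $B_{F_2}$ are isomorphic as $F_2$-algebras.
   Context: Algebras are not necessarily associative, commutative or unital. Dimension means the cardinality of a $K$-vector space basis. For a $K$-algebra $A$ and a field extension $K\subseteq F$, $A_F:=A\otimes_K F$, regarded as an $F$-algebra. *)

theory Defs
  imports
    "HOL-Library.Poly_Mapping"
    "HOL-Computational_Algebra.Computational_Algebra"
    "HOL-Computational_Algebra.Group_Closure"
begin

unbundle cardinal_syntax

section \<open>Algebras over a field\<close>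

text \<open>Algebras need not be associative, commutative or unital: an algebra is a vector space
  with a bilinear product.\<close>

locale nonassoc_algebra = vector_space scale
  for scale :: "'k::field \<Rightarrow> 'a::ab_group_add \<Rightarrow> 'a" +
  fixes mul :: "'a \<Rightarrow> 'a \<Rightarrow> 'a"
  assumes linear_mult_right: "Vector_Spaces.linear scale scale (\<lambda>y. mul x y)"
    and linear_mult_left: "Vector_Spaces.linear scale scale (\<lambda>x. mul x y)"

text \<open>The library's \<^const>\<open>vector_space.dim\<close> is a natural number, hence useless for
  infinite-dimensional spaces; the dimension is a cardinal here.\<close>

definition (in vector_space) has_dimension :: "'w rel \<Rightarrow> bool" where
  "has_dimension \<omega> \<longleftrightarrow> (\<exists>B. independent B \<and> span B = UNIV \<and> |B| =o \<omega>)"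

definition field_embedding :: "('k::field \<Rightarrow> 'f::field) \<Rightarrow> bool" where
  "field_embedding \<iota> \<longleftrightarrow>
     \<iota> 1 = 1 \<and> (\<forall>x y. \<iota> (x + y) = \<iota> x + \<iota> y) \<and> (\<forall>x y. \<iota> (x * y) = \<iota> x * \<iota> y)"


section \<open>Scalar extension\<close>

text \<open>The tensor product of \<open>A\<close> and \<open>F\<close> over \<open>K\<close> is the free abelian group on \<open>A \<times> F\<close> modulo the
  subgroup generated by the relations below, where \<open>K\<close> acts on \<open>F\<close> through the embedding \<open>\<iota>\<close>.
  As it depends on the terms \<open>scale\<close> and \<open>\<iota>\<close>, it is not a type but a set of equivalence classes.\<close>

definition tensor_relators ::
  "('k::field \<Rightarrow> 'a::ab_group_add \<Rightarrow> 'a) \<Rightarrow> ('k \<Rightarrow> 'f::field) \<Rightarrow> ('a \<times> 'f \<Rightarrow>\<^sub>0 int) set" where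
  "tensor_relators scale \<iota> =
     {frag_of (a + b, f) - frag_of (a, f) - frag_of (b, f) |a b f. True} \<union>
     {frag_of (a, f + g) - frag_of (a, f) - frag_of (a, g) |a f g. True} \<union>
     {frag_of (scale c a, f) - frag_of (a, \<iota> c * f) |c a f. True}"

definition tensor_cong ::
  "('k::field \<Rightarrow> 'a::ab_group_add \<Rightarrow> 'a) \<Rightarrow> ('k \<Rightarrow> 'f::field) \<Rightarrow> ('a \<times> 'f \<Rightarrow>\<^sub>0 int) rel" where
  "tensor_cong scale \<iota> = {(x, y). x - y \<in> group_closure (tensor_relators scale \<iota>)}"

text \<open>On representatives, the action and the product are the additive extensions of
  \<open>f (a \<otimes> g) = a \<otimes> f g\<close> and \<open>(a \<otimes> f) (b \<otimes> g) = a b \<otimes> f g\<close>.\<close>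

definition pre_smult :: "'f::field \<Rightarrow> ('a \<times> 'f \<Rightarrow>\<^sub>0 int) \<Rightarrow> ('a \<times> 'f \<Rightarrow>\<^sub>0 int)" where
  "pre_smult f = frag_extend (\<lambda>(a, g). frag_of (a, f * g))"

definition pre_mult ::
  "('a \<Rightarrow> 'a \<Rightarrow> 'a) \<Rightarrow> ('a \<times> 'f::field \<Rightarrow>\<^sub>0 int) \<Rightarrow> ('a \<times> 'f \<Rightarrow>\<^sub>0 int) \<Rightarrow> ('a \<times> 'f \<Rightarrow>\<^sub>0 int)" where
  "pre_mult mul x y =
     frag_extend (\<lambda>(a, f). frag_extend (\<lambda>(b, g). frag_of (mul a b, f * g)) y) x"

record ('f, 'v) algebra_struct =
  alg_carrier :: "'v set"
  alg_add :: "'v \<Rightarrow> 'v \<Rightarrow> 'v"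
  alg_smult :: "'f \<Rightarrow> 'v \<Rightarrow> 'v"
  alg_mult :: "'v \<Rightarrow> 'v \<Rightarrow> 'v"

definition scalar_extension ::
  "('k::field \<Rightarrow> 'a::ab_group_add \<Rightarrow> 'a) \<Rightarrow> ('a \<Rightarrow> 'a \<Rightarrow> 'a) \<Rightarrow> ('k \<Rightarrow> 'f::field)
     \<Rightarrow> ('f, ('a \<times> 'f \<Rightarrow>\<^sub>0 int) set) algebra_struct" where
  "scalar_extension scale mul \<iota> = (let R = tensor_cong scale \<iota> in
     \<lparr>alg_carrier = UNIV // R,
      alg_add = (\<lambda>X Y. \<Union>x\<in>X. \<Union>y\<in>Y. R `` {x + y}),
      alg_smult = (\<lambda>f X. \<Union>x\<in>X. R `` {pre_smult f x}),
      alg_mult = (\<lambda>X Y. \<Union>x\<in>X. \<Union>y\<in>Y. R `` {pre_mult mul x y})\<rparr>)"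

definition algebra_isomorphic ::
  "('f, 'v) algebra_struct \<Rightarrow> ('f, 'w) algebra_struct \<Rightarrow> bool" where
  "algebra_isomorphic V W \<longleftrightarrow> (\<exists>\<phi>. bij_betw \<phi> (alg_carrier V) (alg_carrier W) \<and>
     (\<forall>x\<in>alg_carrier V. \<forall>y\<in>alg_carrier V. \<phi> (alg_add V x y) = alg_add W (\<phi> x) (\<phi> y)) \<and>
     (\<forall>c. \<forall>x\<in>alg_carrier V. \<phi> (alg_smult V c x) = alg_smult W c (\<phi> x)) \<and>
     (\<forall>x\<in>alg_carrier V. \<forall>y\<in>alg_carrier V. \<phi> (alg_mult V x y) = alg_mult W (\<phi> x) (\<phi> y)))"


section \<open>The operations do not depend on representatives\<close>

lemma equiv_tensor_cong: "equiv UNIV (tensor_cong scale \<iota>)"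
proof (rule equivI)
  let ?C = "group_closure (tensor_relators scale \<iota>)"
  show "sym (tensor_cong scale \<iota>)"
  proof (rule symI)
    fix x y assume "(x, y) \<in> tensor_cong scale \<iota>"
    then have "- (x - y) \<in> ?C" by (simp only: group_closure_minus_iff) (simp add: tensor_cong_def)
    then show "(y, x) \<in> tensor_cong scale \<iota>" by (simp add: tensor_cong_def)
  qed
  show "trans (tensor_cong scale \<iota>)"
  proof (rule transI)
    fix x y z assume "(x, y) \<in> tensor_cong scale \<iota>" "(y, z) \<in> tensor_cong scale \<iota>"
    then have "(x - y) + (y - z) \<in> ?C" by (intro group_closure_add) (simp_all add: tensor_cong_def)
    then show "(x, z) \<in> tensor_cong scale \<iota>" by (simp add: tensor_cong_def)
  qed
qed (auto simp: refl_on_def tensor_cong_def)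

lemma tensor_relators_intros:
  "frag_of (a + b, f) - frag_of (a, f) - frag_of (b, f) \<in> tensor_relators scale \<iota>"
  "frag_of (a, f + g) - frag_of (a, f) - frag_of (a, g) \<in> tensor_relators scale \<iota>"
  "frag_of (scale c a, f) - frag_of (a, \<iota> c * f) \<in> tensor_relators scale \<iota>"
  unfolding tensor_relators_def by blast+

lemma tensor_relators_cases:
  assumes "r \<in> tensor_relators scale \<iota>"
  obtains (left) a b f where "r = frag_of (a + b, f) - frag_of (a, f) - frag_of (b, f)"
    | (right) a f g where "r = frag_of (a, f + g) - frag_of (a, f) - frag_of (a, g)"
    | (scale) c a f where "r = frag_of (scale c a, f) - frag_of (a, \<iota> c * f)"
  using assms unfolding tensor_relators_def by blast

lemma tensor_cong_add:
  assumes "(x, x') \<in> tensor_cong scale \<iota>" "(y, y') \<in> tensor_cong scale \<iota>"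
  shows "(x + y, x' + y') \<in> tensor_cong scale \<iota>"
  using group_closure_add[of "x - x'" _ "y - y'"] assms by (simp add: tensor_cong_def algebra_simps)

lemma frag_extend_closure:
  assumes "\<And>z. z \<in> S \<Longrightarrow> frag_extend h z \<in> group_closure T" "x \<in> group_closure S"
  shows "frag_extend h x \<in> group_closure T"
  using assms(2)
proof induction
  case (base s)
  then show ?case using assms(1) by auto
next
  case (diff s t)
  then show ?case by (simp add: frag_extend_diff group_closure.diff)
qed

lemma pre_smult_cong:
  assumes "(x, x') \<in> tensor_cong scale \<iota>"
  shows "(pre_smult f x, pre_smult f x') \<in> tensor_cong scale \<iota>"
proof -
  have "pre_smult f r \<in> tensor_relators scale \<iota>" if "r \<in> tensor_relators scale \<iota>" for r
    using that
  proof (cases rule: tensor_relators_cases)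
    case (scale c a g)
    then show ?thesis
      using tensor_relators_intros(3)[of scale c a "f * g" \<iota>]
      by (simp add: pre_smult_def frag_extend_diff mult.left_commute)
  qed (simp_all add: pre_smult_def frag_extend_diff distrib_left tensor_relators_intros)
  then have "pre_smult f z \<in> group_closure (tensor_relators scale \<iota>)"
    if "z \<in> group_closure (tensor_relators scale \<iota>)" for z
    unfolding pre_smult_def by (intro frag_extend_closure[OF _ that] group_closure.base) auto
  from this[of "x - x'"] assms show ?thesis
    by (simp add: tensor_cong_def pre_smult_def frag_extend_diff)
qed

lemma pre_mult_diff_left: "pre_mult mul (x - x') y = pre_mult mul x y - pre_mult mul x' y"
  by (simp add: pre_mult_def frag_extend_diff)

lemma pre_mult_swap:
  "pre_mult mul x y = frag_extend (\<lambda>(b, g). frag_extend (\<lambda>(a, f). frag_of (mul a b, f * g)) x) y"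
proof -
  have "frag_extend (\<lambda>p. frag_extend (h p) y) x = frag_extend (\<lambda>q. frag_extend (\<lambda>p. h p q) x) y"
    for h :: "'a \<times> 'b \<Rightarrow> 'a \<times> 'b \<Rightarrow> 'a \<times> 'b \<Rightarrow>\<^sub>0 int"
    unfolding frag_extend_def frag_cmul_sum frag_cmul_cmul
    by (subst sum.swap) (simp add: mult.commute)
  from this[of "\<lambda>(a, f) (b, g). frag_of (mul a b, f * g)"] show ?thesis
    unfolding pre_mult_def by (simp add: case_prod_unfold)
qed

context nonassoc_algebra
begin

lemma mult_simps:
  "mul (a + b) c = mul a c + mul b c" "mul a (b + c) = mul a b + mul a c"
  "mul (scale r a) b = scale r (mul a b)" "mul a (scale r b) = scale r (mul a b)"
  using linear_mult_left linear_mult_right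
  by (simp_all add: Vector_Spaces.linear_iff)

lemma pre_mult_cong:
  fixes \<iota> :: "'k \<Rightarrow> 'f::field"
  assumes "(x, x') \<in> tensor_cong scale \<iota>" "(y, y') \<in> tensor_cong scale \<iota>"
  shows "(pre_mult mul x y, pre_mult mul x' y') \<in> tensor_cong scale \<iota>"
proof -
  let ?T = "tensor_relators scale \<iota>"
  have ext: "frag_extend h z \<in> group_closure ?T" if "\<And>q. h q \<in> group_closure ?T"
    for h :: "'a \<times> 'f \<Rightarrow> 'a \<times> 'f \<Rightarrow>\<^sub>0 int" and z
    using subset_UNIV[of "Poly_Mapping.keys z"]
    by (induction z rule: frag_induction) (simp_all add: that frag_extend_diff group_closure.diff)
  have left: "pre_mult mul z w \<in> group_closure ?T" if z: "z \<in> group_closure ?T" for z w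
  proof -
    have "frag_extend (\<lambda>(a, f). frag_of (mul a b, f * g)) r \<in> ?T" if "r \<in> ?T" for r b g
      using that
      by (cases rule: tensor_relators_cases)
         (simp_all add: frag_extend_diff mult_simps distrib_right mult.assoc tensor_relators_intros)
    then have "frag_extend (\<lambda>(a, f). frag_of (mul a b, f * g)) z \<in> group_closure ?T" for b g
      by (intro frag_extend_closure[OF _ z] group_closure.base) auto
    then show ?thesis unfolding pre_mult_swap by (intro ext) auto
  qed
  have right: "pre_mult mul w z \<in> group_closure ?T" if z: "z \<in> group_closure ?T" for z w
  proof -
    have "frag_extend (\<lambda>(b, g). frag_of (mul a b, f * g)) r \<in> ?T" if "r \<in> ?T" for r a f
      using that
    proof (cases rule: tensor_relators_cases)
      case (scale c b g)
      then show ?thesis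
        using tensor_relators_intros(3)[of scale c "mul a b" "f * g" \<iota>]
        by (simp add: frag_extend_diff mult_simps mult.left_commute)
    qed (simp_all add: frag_extend_diff mult_simps distrib_left tensor_relators_intros)
    then have "frag_extend (\<lambda>(b, g). frag_of (mul a b, f * g)) z \<in> group_closure ?T" for a f
      by (intro frag_extend_closure[OF _ z] group_closure.base) auto
    then show ?thesis unfolding pre_mult_def by (intro ext) auto
  qed
  have "pre_mult mul x y - pre_mult mul x' y' =
      pre_mult mul (x - x') y + pre_mult mul x' (y - y')"
    unfolding pre_mult_diff_left by (simp add: pre_mult_swap frag_extend_diff)
  moreover have "x - x' \<in> group_closure ?T" "y - y' \<in> group_closure ?T"
    using assms by (simp_all add: tensor_cong_def)
  ultimately show ?thesis
    using left right by (simp add: tensor_cong_def group_closure_add)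
qed

end

end

theory Submission
  imports Defs
begin

text \<open>
  The field \<open>F\<close> can be eliminated: for every extension \<open>F\<close> of \<open>K\<close>, the algebras \<open>A\<^sub>F\<close> and \<open>B\<^sub>F\<close> are isomorphic
  if and only if \<open>A\<close> and \<open>B\<close> are isomorphic over \<open>K\<close> (\<open>scalar_extension_iso_iff\<close>). One direction is base
  change (\<open>lifts_of_linear_algebra_iso\<close>).

  For the other direction, choose bases of \<open>A\<close> and \<open>B\<close>. An isomorphism over \<open>F\<close> and its inverse become a pair
  of row-finite matrices with entries in \<open>F\<close>, and the properties of being inverse to each other and of being
  multiplicative become polynomial equations whose coefficients are the structure constants of \<open>A\<close> and
  \<open>B\<close>, which lie in \<open>K\<close>. A ring homomorphism to \<open>K\<close>, defined on a subring of \<open>F\<close> that contains the entries and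
  the structure constants, and fixing the latter, turns this solution into one over \<open>K\<close>, that is, into an
  isomorphism between \<open>A\<close> and \<open>B\<close> (\<open>descend_isomorphism\<close>).

  It remains to find the homomorphism. If the dimension is finite, there are finitely many entries, and
  a finitely generated \<open>K\<close>-algebra inside \<open>F\<close> has a \<open>K\<close>-valued point since \<open>K\<close> is algebraically closed
  (\<open>ex_specialization_finite\<close>). If the dimension \<open>\<omega>\<close> is infinite, the entries and the structure constants
  generate a ring of cardinality at most \<open>\<omega>\<close>. As \<open>\<omega> < |K|\<close>, this ring even embeds into \<open>K\<close> over the ring of
  constants (\<open>ex_specialization_infinite\<close>): algebraic elements have a place to go because \<open>K\<close> is algebraically
  closed, transcendental ones because fewer than \<open>|K|\<close> elements of \<open>K\<close> are algebraic over the part of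
  \<open>K\<close> already used.
\<close>

section \<open>Partial ring homomorphisms between fields\<close>

definition polys_over :: "'a::zero set \<Rightarrow> 'a poly set" where
  "polys_over S = {p. \<forall>i. coeff p i \<in> S}"

definition adjoin :: "'a::comm_semiring_0 set \<Rightarrow> 'a \<Rightarrow> 'a set" where
  "adjoin S x = (\<lambda>p. poly p x) ` polys_over S"

text \<open>A stand-in for the minimal polynomial that stays within \<open>S\<close>, where leading coefficients need not be
  invertible. It exists exactly when \<open>x\<close> is algebraic over the field of fractions of \<open>S\<close>.\<close>

definition min_relation :: "'a::comm_semiring_0 set \<Rightarrow> 'a \<Rightarrow> 'a poly \<Rightarrow> bool" where
  "min_relation S x q \<longleftrightarrow> q \<in> polys_over S \<and> q \<noteq> 0 \<and> poly q x = 0 \<and>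
     (\<forall>p\<in>polys_over S. p \<noteq> 0 \<longrightarrow> poly p x = 0 \<longrightarrow> degree q \<le> degree p)"

locale subring =
  fixes S :: "'a::field set"
  assumes one_mem: "1 \<in> S"
    and diff_mem: "x \<in> S \<Longrightarrow> y \<in> S \<Longrightarrow> x - y \<in> S"
    and mult_mem: "x \<in> S \<Longrightarrow> y \<in> S \<Longrightarrow> x * y \<in> S"
begin

lemma zero_mem: "0 \<in> S"
  using diff_mem[OF one_mem one_mem] by simp

lemma minus_mem: "x \<in> S \<Longrightarrow> - x \<in> S"
  using diff_mem[OF zero_mem] by fastforce

lemma add_mem: "x \<in> S \<Longrightarrow> y \<in> S \<Longrightarrow> x + y \<in> S"
  using diff_mem[OF _ minus_mem, of x y] by simp

lemma power_mem: "x \<in> S \<Longrightarrow> x ^ n \<in> S"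
  by (induction n) (auto simp: one_mem mult_mem)

lemma sum_mem: "(\<And>i. i \<in> I \<Longrightarrow> f i \<in> S) \<Longrightarrow> sum f I \<in> S"
  by (induction I rule: infinite_finite_induct) (auto simp: zero_mem add_mem)

abbreviation polys :: "'a poly set" where
  "polys \<equiv> polys_over S"

lemma coeff_polys: "p \<in> polys \<Longrightarrow> coeff p i \<in> S"
  by (simp add: polys_over_def)

lemma zero_polys: "0 \<in> polys"
  by (simp add: polys_over_def zero_mem)

lemma pCons_polys: "a \<in> S \<Longrightarrow> p \<in> polys \<Longrightarrow> pCons a p \<in> polys"
  by (auto simp: polys_over_def coeff_pCons split: nat.split)

lemma const_polys: "a \<in> S \<Longrightarrow> [:a:] \<in> polys"
  by (intro pCons_polys zero_polys)

lemma one_polys: "1 \<in> polys"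
  using const_polys[OF one_mem] by (simp add: one_pCons)

lemma add_polys: "p \<in> polys \<Longrightarrow> q \<in> polys \<Longrightarrow> p + q \<in> polys"
  by (simp add: polys_over_def add_mem)

lemma diff_polys: "p \<in> polys \<Longrightarrow> q \<in> polys \<Longrightarrow> p - q \<in> polys"
  by (simp add: polys_over_def diff_mem)

lemma mult_polys: "p \<in> polys \<Longrightarrow> q \<in> polys \<Longrightarrow> p * q \<in> polys"
  by (auto simp: polys_over_def coeff_mult intro!: sum_mem mult_mem)

lemma smult_polys: "a \<in> S \<Longrightarrow> p \<in> polys \<Longrightarrow> smult a p \<in> polys"
  by (simp add: polys_over_def mult_mem)

lemma monom_polys: "a \<in> S \<Longrightarrow> monom a n \<in> polys"
  by (auto simp: polys_over_def zero_mem)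

text \<open>Division with remainder by a polynomial that is not monic: each step of the long division costs one
  factor of the leading coefficient, which keeps all coefficients in \<open>S\<close>.\<close>

lemma pseudo_division:
  assumes g: "g \<in> polys" "g \<noteq> 0" and f: "f \<in> polys"
  shows "\<exists>N t s. t \<in> polys \<and> s \<in> polys \<and> smult (lead_coeff g ^ N) f = g * t + s
    \<and> (s = 0 \<or> degree s < degree g)"
  using f
proof (induction "degree f" arbitrary: f rule: less_induct)
  case less
  show ?case
  proof (cases "f = 0 \<or> degree f < degree g")
    case True
    then show ?thesis
      using less.prems zero_polys by (intro exI[of _ 0] exI[of _ 0] exI[of _ f]) auto
  next
    case False
    define m where "m = monom (lead_coeff f) (degree f - degree g)"
    define f' where "f' = smult (lead_coeff g) f - g * m"
    have m: "m \<in> polys"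
      unfolding m_def by (intro monom_polys coeff_polys less.prems)
    have f': "f' \<in> polys"
      unfolding f'_def using g less.prems m by (intro diff_polys smult_polys mult_polys coeff_polys)
    have lm: "lead_coeff m = lead_coeff f"
      using False by (simp add: m_def degree_monom_eq)
    then have "m \<noteq> 0" using False by auto
    then have deg_gm: "degree (g * m) = degree f"
      using False g by (simp add: m_def degree_mult_eq degree_monom_eq)
    have "coeff (g * m) (degree f) = lead_coeff g * lead_coeff f"
      unfolding deg_gm[symmetric] lead_coeff_mult lm ..
    then have top: "coeff f' (degree f) = 0"
      by (simp add: f'_def)
    have le: "degree f' \<le> degree f"
      unfolding f'_def using deg_gm degree_diff_le[of "smult (lead_coeff g) f" "degree f" "g * m"]
      by (simp add: degree_smult_le)
    show ?thesis
    proof (cases "f' = 0")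
      case True
      then have "smult (lead_coeff g ^ 1) f = g * m + 0"
        by (simp add: f'_def)
      then show ?thesis
        using m zero_polys by blast
    next
      case nz: False
      show ?thesis
      proof (cases "degree f' < degree f")
        case True
        from less.hyps[OF this f'] obtain N t s where
          *: "t \<in> polys" "s \<in> polys" "smult (lead_coeff g ^ N) f' = g * t + s"
            "s = 0 \<or> degree s < degree g"
          by blast
        have "smult (lead_coeff g ^ Suc N) f = smult (lead_coeff g ^ N) (f' + g * m)"
          by (simp add: f'_def mult.commute)
        also have "\<dots> = g * (t + smult (lead_coeff g ^ N) m) + s"
          by (simp add: smult_add_right *(3) algebra_simps)
        finally show ?thesis
          using * m g
          by (intro exI[of _ "Suc N"] exI[of _ "t + smult (lead_coeff g ^ N) m"] exI[of _ s])
             (auto intro!: add_polys smult_polys power_mem coeff_polys)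
      next
        case False
        then have "degree f' = degree f" using le by simp
        then have "f' = 0" using top by (metis leading_coeff_0_iff)
        with nz show ?thesis by simp
      qed
    qed
  qed
qed

lemma ex_min_relation:
  assumes "p \<in> polys" "p \<noteq> 0" "poly p x = 0"
  shows "\<exists>q. min_relation S x q"
  using ex_has_least_nat[of "\<lambda>p. p \<in> polys \<and> p \<noteq> 0 \<and> poly p x = 0" p degree] assms
  unfolding min_relation_def by blast

lemma min_relation_degree_pos: "min_relation S x q \<Longrightarrow> degree q > 0"
  by (auto simp: min_relation_def elim!: degree_eq_zeroE intro!: gr0I)

text \<open>The remainder of a pseudo-division vanishes at \<open>x\<close> and has a smaller degree than \<open>q\<close>, so it is zero.
  Thus \<open>q\<close> generates all relations of \<open>x\<close> up to powers of its leading coefficient.\<close>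

lemma min_relation_pseudo_dvd:
  assumes "min_relation S x q" "p \<in> polys" "poly p x = 0"
  shows "\<exists>N. \<exists>t\<in>polys. smult (lead_coeff q ^ N) p = q * t"
proof -
  obtain N t s where *: "t \<in> polys" "s \<in> polys" "smult (lead_coeff q ^ N) p = q * t + s"
    "s = 0 \<or> degree s < degree q"
    using pseudo_division[of q p] assms by (auto simp: min_relation_def)
  from arg_cong[OF *(3), of "\<lambda>p. poly p x"] have "poly s x = 0"
    using assms by (simp add: min_relation_def)
  then have "s = 0"
    using assms(1) *(2,4) unfolding min_relation_def by (meson not_le)
  with * show ?thesis by auto
qed

text \<open>Over the field of fractions of \<open>S\<close> the polynomial \<open>q\<close> is irreducible and \<open>p\<close> is not a multiple of it, so the two
  generate the unit ideal; clearing denominators leaves a nonzero constant \<open>r\<close>. A homomorphism that does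
  not kill \<open>r\<close> cannot let \<open>p\<close> and \<open>q\<close> acquire a common root.\<close>

lemma min_relation_bezout:
  assumes q: "min_relation S x q" and p: "p \<in> polys" "poly p x \<noteq> 0"
  shows "\<exists>A\<in>polys. \<exists>B\<in>polys. \<exists>r\<in>S. r \<noteq> 0 \<and> A * p + B * q = [:r:]"
proof -
  define I where "I = {A * p + B * q | A B. A \<in> polys \<and> B \<in> polys}"
  have q': "q \<in> polys" "q \<noteq> 0" "poly q x = 0" using q by (auto simp: min_relation_def)
  have "p = 1 * p + 0 * q" "q = 0 * p + 1 * q" by simp_all
  then have pI: "p \<in> I" and qI: "q \<in> I"
    unfolding I_def using one_polys zero_polys by blast+
  have Isub: "I \<subseteq> polys"
    using p q' by (auto simp: I_def intro!: add_polys mult_polys)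
  have step: "smult c u - g * t \<in> I" if "u \<in> I" "g \<in> I" "c \<in> S" "t \<in> polys" for u g c t
  proof -
    from that obtain A B C D where *: "A \<in> polys" "B \<in> polys" "C \<in> polys" "D \<in> polys"
      "u = A * p + B * q" "g = C * p + D * q" by (auto simp: I_def)
    have "smult c u - g * t = (smult c A - C * t) * p + (smult c B - D * t) * q"
      by (simp add: * algebra_simps smult_add_right)
    then show ?thesis unfolding I_def
      using * that by (blast intro: diff_polys smult_polys mult_polys)
  qed
  \<comment> \<open>An element of least degree of the ideal generated by p and q plays the role of their gcd.\<close>
  obtain g where g: "g \<in> I" "g \<noteq> 0" and min: "\<And>u. u \<in> I \<Longrightarrow> u \<noteq> 0 \<Longrightarrow> degree g \<le> degree u"
    using ex_has_least_nat[of "\<lambda>u. u \<in> I \<and> u \<noteq> 0" q degree] qI q' by blast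
  have dvd: "\<exists>N. \<exists>t\<in>polys. smult (lead_coeff g ^ N) u = g * t" if u: "u \<in> I" for u
  proof -
    obtain N t s where *: "t \<in> polys" "s \<in> polys" "smult (lead_coeff g ^ N) u = g * t + s"
      "s = 0 \<or> degree s < degree g"
      using pseudo_division[of g u] g u Isub by blast
    have "s = smult (lead_coeff g ^ N) u - g * t" using *(3) by simp
    then have "s \<in> I"
      using step[OF u g(1) _ *(1)] power_mem coeff_polys g(1) Isub by (metis subsetD)
    with min *(4) have "s = 0" by (meson not_le)
    with * show ?thesis by auto
  qed
  obtain N t where t: "t \<in> polys" "smult (lead_coeff g ^ N) q = g * t" using dvd[OF qI] by blast
  obtain M s where s: "s \<in> polys" "smult (lead_coeff g ^ M) p = g * s" using dvd[OF pI] by blast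
  from arg_cong[OF s(2), of "\<lambda>p. poly p x"] have "poly g x \<noteq> 0"
    using p g by auto
  with arg_cong[OF t(2), of "\<lambda>p. poly p x"] q' have "poly t x = 0"
    by auto
  moreover have "t \<noteq> 0" using t(2) q' g by auto
  ultimately have "degree q \<le> degree t"
    using q t(1) by (auto simp: min_relation_def)
  moreover have "degree q = degree g + degree t"
    using arg_cong[OF t(2), of degree] g \<open>t \<noteq> 0\<close> by (simp add: degree_mult_eq)
  ultimately have "degree g = 0" by simp
  then obtain r where r: "g = [:r:]" by (rule degree_eq_zeroE)
  then have "r \<in> S" using g Isub coeff_polys[of g 0] by auto
  moreover have "r \<noteq> 0" using g r by auto
  ultimately show ?thesis using g(1) unfolding I_def r by (smt (verit) mem_Collect_eq)
qed

lemma subring_adjoin: "subring (adjoin S x)"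
proof
  show "1 \<in> adjoin S x" unfolding adjoin_def using one_polys by (intro image_eqI[of _ _ 1]) simp_all
next
  fix a b assume "a \<in> adjoin S x" "b \<in> adjoin S x"
  then obtain p q where *: "p \<in> polys" "q \<in> polys" "a = poly p x" "b = poly q x"
    by (auto simp: adjoin_def)
  then have "a - b = poly (p - q) x" "a * b = poly (p * q) x" by simp_all
  then show "a - b \<in> adjoin S x" "a * b \<in> adjoin S x"
    unfolding adjoin_def using * diff_polys mult_polys by blast+
qed

lemma subset_adjoin: "S \<subseteq> adjoin S x"
proof
  fix a assume "a \<in> S"
  then show "a \<in> adjoin S x"
    unfolding adjoin_def by (intro image_eqI[of _ _ "[:a:]"] const_polys) simp_all
qed

lemma mem_adjoin: "x \<in> adjoin S x"
  unfolding adjoin_def using pCons_polys[OF zero_mem one_polys]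
  by (intro image_eqI[of _ _ "pCons 0 1"]) simp_all

end

locale subring_hom = subring S for S :: "'a::field set" +
  fixes h :: "'a \<Rightarrow> 'b::field"
  assumes h_one: "h 1 = 1"
    and h_diff: "x \<in> S \<Longrightarrow> y \<in> S \<Longrightarrow> h (x - y) = h x - h y"
    and h_mult: "x \<in> S \<Longrightarrow> y \<in> S \<Longrightarrow> h (x * y) = h x * h y"
begin

lemma h_zero [simp]: "h 0 = 0"
  using h_diff[OF one_mem one_mem] by simp

lemma h_add: "x \<in> S \<Longrightarrow> y \<in> S \<Longrightarrow> h (x + y) = h x + h y"
  using h_diff[of x "- y"] h_diff[of 0 y] by (simp add: minus_mem zero_mem)

lemma h_power: "x \<in> S \<Longrightarrow> h (x ^ n) = h x ^ n"
  by (induction n) (simp_all add: h_one h_mult power_mem)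

lemma h_sum: "(\<And>i. i \<in> I \<Longrightarrow> f i \<in> S) \<Longrightarrow> h (sum f I) = (\<Sum>i\<in>I. h (f i))"
  by (induction I rule: infinite_finite_induct) (auto simp: h_add sum_mem)

lemma map_poly_add: "p \<in> polys \<Longrightarrow> q \<in> polys \<Longrightarrow> map_poly h (p + q) = map_poly h p + map_poly h q"
  by (rule poly_eqI) (simp add: coeff_map_poly h_add coeff_polys)

lemma map_poly_diff: "p \<in> polys \<Longrightarrow> q \<in> polys \<Longrightarrow> map_poly h (p - q) = map_poly h p - map_poly h q"
  by (rule poly_eqI) (simp add: coeff_map_poly h_diff coeff_polys)

lemma map_poly_mult: "p \<in> polys \<Longrightarrow> q \<in> polys \<Longrightarrow> map_poly h (p * q) = map_poly h p * map_poly h q"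
  by (rule poly_eqI)
     (simp add: coeff_map_poly coeff_mult h_sum h_mult coeff_polys mult_mem)

lemma map_poly_smult: "a \<in> S \<Longrightarrow> p \<in> polys \<Longrightarrow> map_poly h (smult a p) = smult (h a) (map_poly h p)"
  by (rule poly_eqI) (simp add: coeff_map_poly h_mult coeff_polys)

lemma map_poly_const: "map_poly h [:a:] = [:h a:]"
  by (rule poly_eqI) (simp add: coeff_map_poly coeff_pCons split: nat.split)

text \<open>A root \<open>\<xi>\<close> of the images of all relations of \<open>x\<close> is a possible value for \<open>x\<close>: sending \<open>poly p x\<close> to
  \<open>poly (map_poly h p) \<xi>\<close> is then well defined.\<close>

lemma extend_adjoin:
  assumes wd: "\<And>p. p \<in> polys \<Longrightarrow> poly p x = 0 \<Longrightarrow> poly (map_poly h p) \<xi> = 0"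
  obtains h' where "subring_hom (adjoin S x) h'"
    "\<And>p. p \<in> polys \<Longrightarrow> h' (poly p x) = poly (map_poly h p) \<xi>"
    "\<And>s. s \<in> S \<Longrightarrow> h' s = h s"
proof -
  define h' where "h' y = poly (map_poly h (SOME p. p \<in> polys \<and> poly p x = y)) \<xi>" for y
  have h': "h' (poly p x) = poly (map_poly h p) \<xi>" if p: "p \<in> polys" for p
  proof -
    define q where "q = (SOME q. q \<in> polys \<and> poly q x = poly p x)"
    have q: "q \<in> polys" "poly q x = poly p x"
      using someI[of "\<lambda>q. q \<in> polys \<and> poly q x = poly p x" p] p unfolding q_def by auto
    then have "poly (map_poly h (q - p)) \<xi> = 0"
      by (intro wd diff_polys p) auto
    then show ?thesis
      using q p by (simp add: h'_def q_def[symmetric] map_poly_diff)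
  qed
  have const: "h' s = h s" if "s \<in> S" for s
    using h'[OF const_polys[OF that]] by (simp add: map_poly_const)
  interpret A: subring "adjoin S x" by (rule subring_adjoin)
  have "subring_hom (adjoin S x) h'"
  proof
    show "h' 1 = 1" using const[OF one_mem] h_one by simp
  next
    fix a b assume "a \<in> adjoin S x" "b \<in> adjoin S x"
    then obtain p q where *: "p \<in> polys" "q \<in> polys" "a = poly p x" "b = poly q x"
      by (auto simp: adjoin_def)
    then show "h' (a - b) = h' a - h' b" "h' (a * b) = h' a * h' b"
      using h'[of "p - q"] h'[of "p * q"]
      by (simp_all add: h' diff_polys mult_polys map_poly_diff map_poly_mult)
  qed
  with h' const that show thesis by blast
qed

text \<open>When the leading coefficient of \<open>q\<close> survives, it suffices to take a root of the image of \<open>q\<close> itself,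
  because \<open>q\<close> divides every relation up to powers of that coefficient.\<close>

lemma min_relation_specialize:
  assumes q: "min_relation S x q" and lc: "h (lead_coeff q) \<noteq> 0"
    and root: "poly (map_poly h q) \<xi> = 0"
    and p: "p \<in> polys" "poly p x = 0"
  shows "poly (map_poly h p) \<xi> = 0"
proof -
  have qp: "q \<in> polys" using q by (simp add: min_relation_def)
  obtain N t where t: "t \<in> polys" "smult (lead_coeff q ^ N) p = q * t"
    using min_relation_pseudo_dvd[OF q p] by blast
  have l: "lead_coeff q \<in> S" by (rule coeff_polys[OF qp])
  have lN: "lead_coeff q ^ N \<in> S" by (rule power_mem[OF l])
  have "smult (h (lead_coeff q) ^ N) (map_poly h p) = map_poly h q * map_poly h t"
    using arg_cong[OF t(2), of "map_poly h"]
    unfolding map_poly_smult[OF lN p(1)] map_poly_mult[OF qp t(1)] h_power[OF l] .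
  from arg_cong[OF this, of "\<lambda>p. poly p \<xi>"] root lc show ?thesis by simp
qed

lemma min_relation_nonzero:
  assumes "A \<in> polys" "B \<in> polys" "p \<in> polys" "q \<in> polys" "A * p + B * q = [:r:]"
    and "h r \<noteq> 0" and root: "poly (map_poly h q) \<xi> = 0"
  shows "poly (map_poly h p) \<xi> \<noteq> 0"
proof -
  have "map_poly h A * map_poly h p + map_poly h B * map_poly h q = [:h r:]"
    using arg_cong[OF assms(5), of "map_poly h"] assms(1-4)
    by (simp add: map_poly_add map_poly_mult mult_polys map_poly_const)
  from arg_cong[OF this, of "\<lambda>p. poly p \<xi>"] root assms(6) show ?thesis by auto
qed

end

lemma map_poly_root:
  fixes k :: "'a::zero \<Rightarrow> 'c::alg_closed_field"
  assumes "k (lead_coeff q) \<noteq> 0" "k 0 = 0" "degree q > 0"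
  shows "\<exists>\<xi>. poly (map_poly k q) \<xi> = 0"
proof -
  have "coeff (map_poly k q) (degree q) \<noteq> 0"
    using assms by (simp add: coeff_map_poly)
  then have "degree q \<le> degree (map_poly k q)" by (rule le_degree)
  then show ?thesis using assms alg_closed_imp_poly_has_root[of "map_poly k q"] by auto
qed

text \<open>Over a finite field, \<open>1 + (\<Prod>c. X - c)\<close> takes the value 1 everywhere.\<close>

lemma infinite_alg_closed: "infinite (UNIV :: 'k::alg_closed_field set)"
proof
  assume fin: "finite (UNIV :: 'k set)"
  define p :: "'k poly" where "p = (\<Prod>c\<in>UNIV. [:-c, 1:]) + 1"
  have d: "degree (\<Prod>c\<in>(UNIV::'k set). [:-c, 1:]) = card (UNIV :: 'k set)"
    by (subst degree_prod_eq_sum_degree) (auto simp: fin)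
  moreover have "card (UNIV :: 'k set) > 0" using fin by (simp add: card_gt_0_iff)
  ultimately have "degree p > 0"
    unfolding p_def by (subst degree_add_eq_left) auto
  then obtain x where "poly p x = 0" using alg_closed_imp_poly_has_root by blast
  moreover have "poly (\<Prod>c\<in>UNIV. [:-c, 1:]) x = 0"
    unfolding poly_prod by (rule prod_zero[OF fin]) (auto intro!: bexI[of _ x])
  ultimately show False by (simp add: p_def)
qed

lemma field_embedding_simps:
  assumes "field_embedding \<iota>"
  shows "\<iota> 1 = 1" "\<iota> (x + y) = \<iota> x + \<iota> y" "\<iota> (x - y) = \<iota> x - \<iota> y" "\<iota> (x * y) = \<iota> x * \<iota> y"
    "\<iota> 0 = 0" "\<iota> x = 0 \<longleftrightarrow> x = 0" "inj \<iota>"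
proof -
  have one: "\<iota> 1 = 1" and add: "\<And>x y. \<iota> (x + y) = \<iota> x + \<iota> y" and mult: "\<And>x y. \<iota> (x * y) = \<iota> x * \<iota> y"
    using assms by (auto simp: field_embedding_def)
  have zero: "\<iota> 0 = 0" using add[of 0 0] by (metis add_0 add_cancel_left_left)
  have diff: "\<iota> (x - y) = \<iota> x - \<iota> y" for x y using add[of "x - y" y] by simp
  have nz: "\<iota> x = 0 \<longleftrightarrow> x = 0" for x
    using mult[of x "inverse x"] one zero by (cases "x = 0") auto
  have "inj \<iota>"
    by (rule injI) (metis diff nz right_minus_eq)
  with one add mult zero diff nz
  show "\<iota> 1 = 1" "\<iota> (x + y) = \<iota> x + \<iota> y" "\<iota> (x - y) = \<iota> x - \<iota> y" "\<iota> (x * y) = \<iota> x * \<iota> y"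
    "\<iota> 0 = 0" "\<iota> x = 0 \<longleftrightarrow> x = 0" "inj \<iota>" by auto
qed

lemma subring_hom_inv_embedding:
  assumes "field_embedding \<iota>"
  shows "subring_hom (range \<iota>) (inv \<iota>)"
proof -
  have inv: "inv \<iota> (\<iota> x) = x" for x using field_embedding_simps(7)[OF assms] by simp
  have "inv \<iota> 1 = 1" using inv[of 1] field_embedding_simps(1)[OF assms] by simp
  moreover have "1 \<in> range \<iota>" using field_embedding_simps(1)[OF assms] by (metis rangeI)
  ultimately show ?thesis
    by unfold_locales (auto simp: inv simp flip: field_embedding_simps(3,4)[OF assms])
qed

text \<open>This is the Nullstellensatz in the form used by the descent: a finitely generated \<open>K\<close>-subalgebra of \<open>F\<close>
  has a \<open>K\<close>-point. The induction adjoins one element at a time, and the clause about \<open>u\<close> is what makes it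
  go through: to adjoin \<open>x\<close>, the homomorphism on the smaller ring must avoid finitely many bad zeros,
  and these are collected in a single product. If \<open>x\<close> is algebraic, the product is that of the leading
  coefficient of a minimal relation and of a Bezout constant; if \<open>x\<close> is transcendental, a coefficient
  of \<open>u\<close> has to survive, and then all but finitely many values for \<open>x\<close> will do.\<close>

lemma ex_specialization_finite:
  fixes \<iota> :: "'k::alg_closed_field \<Rightarrow> 'f::field"
  assumes emb: "field_embedding \<iota>" and "finite Z"
  shows "\<exists>S. subring S \<and> range \<iota> \<union> Z \<subseteq> S \<and>
    (\<forall>u\<in>S - {0}. \<exists>h. subring_hom S h \<and> (\<forall>c. h (\<iota> c) = (c::'k)) \<and> h u \<noteq> 0)"
  using \<open>finite Z\<close>
proof (induction Z)
  case empty
  interpret subring_hom "range \<iota>" "inv \<iota>" by (rule subring_hom_inv_embedding[OF emb])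
  have "inv \<iota> u \<noteq> 0" if "u \<in> range \<iota> - {0}" for u
    using that field_embedding_simps[OF emb] by (auto simp: inv_f_f)
  moreover have "inv \<iota> (\<iota> c) = c" for c
    using field_embedding_simps(7)[OF emb] by simp
  ultimately show ?case
    using subring_axioms subring_hom_axioms by blast
next
  case (insert x Z)
  then obtain S where S: "subring S" "range \<iota> \<union> Z \<subseteq> S" and
    hom: "\<And>u. u \<in> S \<Longrightarrow> u \<noteq> 0 \<Longrightarrow> \<exists>h. subring_hom S h \<and> (\<forall>c. h (\<iota> c) = (c::'k)) \<and> h u \<noteq> 0"
    by auto
  interpret S: subring S by fact
  have "\<exists>h. subring_hom (adjoin S x) h \<and> (\<forall>c. h (\<iota> c) = (c::'k)) \<and> h u \<noteq> 0"
    if u: "u \<in> adjoin S x" "u \<noteq> 0" for u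
  proof -
    from u obtain p where p: "p \<in> polys_over S" "u = poly p x" by (auto simp: adjoin_def)
    have "\<exists>h \<xi>. subring_hom S h \<and> (\<forall>c. h (\<iota> c) = (c::'k)) \<and> poly (map_poly h p) \<xi> \<noteq> 0 \<and>
      (\<forall>p\<in>polys_over S. poly p x = 0 \<longrightarrow> poly (map_poly h p) \<xi> = 0)"
    proof (cases "\<exists>q. q \<in> polys_over S \<and> q \<noteq> 0 \<and> poly q x = 0")
      case True
      then obtain q where q: "min_relation S x q" using S.ex_min_relation by blast
      then have qp: "q \<in> polys_over S" "q \<noteq> 0" by (auto simp: min_relation_def)
      obtain A B r where AB: "A \<in> polys_over S" "B \<in> polys_over S" "r \<in> S" "r \<noteq> 0" "A * p + B * q = [:r:]"
        using S.min_relation_bezout[OF q p(1)] p(2) u(2) by blast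
      obtain h where h: "subring_hom S h" "\<forall>c. h (\<iota> c) = (c::'k)" "h (lead_coeff q * r) \<noteq> 0"
        using hom[of "lead_coeff q * r"] AB qp S.mult_mem S.coeff_polys by auto
      interpret H: subring_hom S h by fact
      have nz: "h (lead_coeff q) \<noteq> 0" "h r \<noteq> 0"
        using h(3) H.h_mult AB qp S.coeff_polys by auto
      obtain \<xi> where \<xi>: "poly (map_poly h q) \<xi> = 0"
        using map_poly_root[of h q] nz S.min_relation_degree_pos[OF q] by auto
      show ?thesis
        using h(1,2) H.min_relation_specialize[OF q nz(1) \<xi>]
          H.min_relation_nonzero[OF AB(1,2) p(1) qp(1) AB(5) nz(2) \<xi>] by blast
    next
      case False
      have "p \<noteq> 0" using p u by auto
      then obtain h where h: "subring_hom S h" "\<forall>c. h (\<iota> c) = (c::'k)" "h (lead_coeff p) \<noteq> 0"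
        using hom[of "lead_coeff p"] S.coeff_polys[OF p(1)] by auto
      interpret H: subring_hom S h by fact
      have "coeff (map_poly h p) (degree p) \<noteq> 0" using h(3) by (simp add: coeff_map_poly)
      then have "map_poly h p \<noteq> 0" by auto
      then have "finite {\<xi>. poly (map_poly h p) \<xi> = 0}" by (rule poly_roots_finite)
      then obtain \<xi> where "poly (map_poly h p) \<xi> \<noteq> 0"
        using infinite_alg_closed[where 'k='k] ex_new_if_finite by blast
      moreover have "\<forall>p\<in>polys_over S. poly p x = 0 \<longrightarrow> poly (map_poly h p) \<xi> = 0"
        using False by force
      ultimately show ?thesis using h by blast
    qed
    then obtain h \<xi> where h: "subring_hom S h" "\<forall>c. h (\<iota> c) = (c::'k)" "poly (map_poly h p) \<xi> \<noteq> 0"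
      "\<And>p. p\<in>polys_over S \<Longrightarrow> poly p x = 0 \<Longrightarrow> poly (map_poly h p) \<xi> = 0" by blast
    interpret H: subring_hom S h by fact
    obtain h' where "subring_hom (adjoin S x) h'"
      "\<And>p. p \<in> polys_over S \<Longrightarrow> h' (poly p x) = poly (map_poly h p) \<xi>"
      "\<And>s. s \<in> S \<Longrightarrow> h' s = h s"
      using H.extend_adjoin[OF h(4)] by blast
    moreover have "\<iota> c \<in> S" for c using S(2) by blast
    ultimately show ?thesis using h p by (intro exI[of _ h']) auto
  qed
  then show ?case
    using S.subring_adjoin[of x] S.subset_adjoin[of x] S.mem_adjoin[of x] S(2)
    by (intro exI[of _ "adjoin S x"] conjI) blast+
qed

section \<open>Subrings of small cardinality\<close>

text \<open>The sets bounded by an infinite cardinal are closed under all constructions of algebra that involve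
  finitely many elements at a time, in particular under generating subrings and taking polynomials.\<close>

locale infinite_cardinal =
  fixes r :: "'r rel"
  assumes card_order: "Card_order r" and infinite_field: "infinite (Field r)"
begin

lemma nat_le: "|UNIV :: nat set| \<le>o r"
  using infinite_field card_of_Field_ordIso[OF card_order]
  by (metis infinite_iff_card_of_nat ordLeq_ordIso_trans)

lemma finite_le: "finite A \<Longrightarrow> |A| \<le>o r"
proof -
  assume "finite A"
  then have "\<exists>f::_ \<Rightarrow> nat. inj_on f A \<and> f ` A \<subseteq> UNIV"
    using finite_imp_inj_to_nat_seg[of A] by auto
  then have "|A| \<le>o |UNIV :: nat set|" by (simp only: card_of_ordLeq)
  then show ?thesis using nat_le ordLeq_transitive by metis
qed

lemma Un_le: "|A| \<le>o r \<Longrightarrow> |B| \<le>o r \<Longrightarrow> |A \<union> B| \<le>o r"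
  using card_of_Un_ordLeq_infinite_Field infinite_field card_order by blast

lemma Times_le: "|A| \<le>o r \<Longrightarrow> |B| \<le>o r \<Longrightarrow> |A \<times> B| \<le>o r"
  using card_of_Times_ordLeq_infinite_Field infinite_field card_order by blast

lemma UN_le: "|I| \<le>o r \<Longrightarrow> (\<And>i. i \<in> I \<Longrightarrow> |A i| \<le>o r) \<Longrightarrow> |\<Union>i\<in>I. A i| \<le>o r"
  using card_of_UNION_ordLeq_infinite_Field infinite_field card_order by blast

lemma image_le: "|A| \<le>o r \<Longrightarrow> |f ` A| \<le>o r"
  using card_of_image ordLeq_transitive by blast

lemma mono_le: "A \<subseteq> B \<Longrightarrow> |B| \<le>o r \<Longrightarrow> |A| \<le>o r"
  using card_of_mono1 ordLeq_transitive by blast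

lemma ex_subring_le:
  fixes Z :: "'f::field set"
  assumes Z: "|Z| \<le>o r"
  shows "\<exists>R. subring R \<and> Z \<subseteq> R \<and> |R| \<le>o r"
proof -
  define R where "R = rec_nat (insert 1 Z)
    (\<lambda>_ X. X \<union> (\<lambda>(x, y). x - y) ` (X \<times> X) \<union> (\<lambda>(x, y). x * y) ` (X \<times> X))"
  have R: "R 0 = insert 1 Z"
    "R (Suc n) = R n \<union> (\<lambda>(x, y). x - y) ` (R n \<times> R n) \<union> (\<lambda>(x, y). x * y) ` (R n \<times> R n)" for n
    by (simp_all add: R_def)
  have mono: "R m \<subseteq> R n" if "m \<le> n" for m n
    by (rule lift_Suc_mono_le[OF _ that]) (auto simp: R)
  have "|R n| \<le>o r" for n
  proof (induction n)
    case 0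
    have "|{1} \<union> Z| \<le>o r" by (intro Un_le finite_le Z) simp
    then show ?case by (simp add: R)
  next
    case (Suc n)
    then show ?case unfolding R by (intro Un_le image_le Times_le)
  qed
  then have "|\<Union>n. R n| \<le>o r" by (intro UN_le nat_le)
  moreover have "subring (\<Union>n. R n)"
  proof
    show "1 \<in> (\<Union>n. R n)" using R(1) by blast
  next
    fix x y assume "x \<in> (\<Union>n. R n)" "y \<in> (\<Union>n. R n)"
    then obtain m n where "x \<in> R m" "y \<in> R n" by blast
    then have "x \<in> R (max m n)" "y \<in> R (max m n)"
      using mono[of m "max m n"] mono[of n "max m n"] by auto
    then have "x - y \<in> R (Suc (max m n))" "x * y \<in> R (Suc (max m n))"
      unfolding R by force+
    then show "x - y \<in> (\<Union>n. R n)" "x * y \<in> (\<Union>n. R n)" by blast+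
  qed
  ultimately show ?thesis using R(1) by blast
qed

lemma polys_over_le:
  fixes T :: "'f::zero set"
  assumes T: "|T| \<le>o r"
  shows "|polys_over T| \<le>o r"
proof -
  define Q where "Q = rec_nat {0} (\<lambda>_ X. (\<lambda>(a, p). pCons a p) ` (T \<times> X))"
  have Q: "Q 0 = {0}" "Q (Suc n) = (\<lambda>(a, p). pCons a p) ` (T \<times> Q n)" for n
    by (simp_all add: Q_def)
  have "|Q n| \<le>o r" for n
  proof (induction n)
    case 0
    then show ?case unfolding Q by (intro finite_le) simp
  next
    case (Suc n)
    then show ?case unfolding Q by (intro image_le Times_le T)
  qed
  then have "|\<Union>n. Q n| \<le>o r" by (intro UN_le nat_le)
  moreover have "p \<in> polys_over T \<Longrightarrow> \<exists>n. p \<in> Q n" for p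
  proof (induction p rule: pCons_induct)
    case 0
    then show ?case using Q(1) by blast
  next
    case (pCons a p)
    have "coeff (pCons a p) i \<in> T" for i using pCons.prems by (simp add: polys_over_def)
    from this[of 0] this[of "Suc _"] have "a \<in> T" "p \<in> polys_over T"
      by (simp_all add: polys_over_def)
    with pCons.IH obtain n where "p \<in> Q n" by blast
    with \<open>a \<in> T\<close> have "pCons a p \<in> Q (Suc n)" unfolding Q by force
    then show ?case by blast
  qed
  ultimately show ?thesis by (intro mono_le[of "polys_over T" "\<Union>n. Q n"]) auto
qed

text \<open>Fewer than \<open>|K|\<close> coefficients yield fewer than \<open>|K|\<close> roots. This is where the strict
  inequality of cardinals enters.\<close>

lemma ex_transcendental:
  fixes T :: "'k::field set"
  assumes "|T| \<le>o r" "r <o |UNIV :: 'k set|"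
  shows "\<exists>\<xi>. \<forall>p\<in>polys_over T. p \<noteq> 0 \<longrightarrow> poly p \<xi> \<noteq> 0"
proof -
  have "|\<Union>p\<in>polys_over T - {0}. {\<xi>. poly p \<xi> = 0}| \<le>o r"
    by (intro UN_le mono_le[OF _ polys_over_le[OF assms(1)]] finite_le poly_roots_finite) auto
  then have "(\<Union>p\<in>polys_over T - {0}. {\<xi>. poly p \<xi> = 0}) \<noteq> UNIV"
    using assms(2) not_ordLess_ordLeq by metis
  then show ?thesis by blast
qed

text \<open>Injectivity replaces the element \<open>u\<close> of the finitely generated case: since no nonzero element of \<open>S\<close> is
  killed, the leading coefficient and the Bezout constant survive without further choice. An algebraic
  \<open>x\<close> goes to a root of the image of a minimal relation, a transcendental one to an element that is
  transcendental over the image of \<open>S\<close>.\<close>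

lemma extend_injective_hom:
  fixes h :: "'f::field \<Rightarrow> 'k::alg_closed_field"
  assumes "subring_hom S h" and S: "|S| \<le>o r" and "r <o |UNIV :: 'k set|"
    and inj: "\<And>u. u \<in> S \<Longrightarrow> h u = 0 \<Longrightarrow> u = 0"
  shows "\<exists>h'. subring_hom (adjoin S x) h' \<and> (\<forall>s\<in>S. h' s = h s) \<and>
    (\<forall>u\<in>adjoin S x. h' u = 0 \<longrightarrow> u = 0)"
proof -
  interpret subring_hom S h by fact
  have "\<exists>\<xi>. \<forall>p\<in>polys. (poly p x = 0 \<longleftrightarrow> poly (map_poly h p) \<xi> = 0)"
  proof (cases "\<exists>q. q \<in> polys \<and> q \<noteq> 0 \<and> poly q x = 0")
    case True
    then obtain q where q: "min_relation S x q" using ex_min_relation by blast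
    then have qp: "q \<in> polys" "q \<noteq> 0" by (auto simp: min_relation_def)
    then have nz: "h (lead_coeff q) \<noteq> 0" using inj[of "lead_coeff q"] coeff_polys by auto
    then obtain \<xi> where \<xi>: "poly (map_poly h q) \<xi> = 0"
      using map_poly_root[of h q] min_relation_degree_pos[OF q] by auto
    have "poly (map_poly h p) \<xi> \<noteq> 0" if p: "p \<in> polys" "poly p x \<noteq> 0" for p
    proof -
      obtain A B c where AB: "A \<in> polys" "B \<in> polys" "c \<in> S" "c \<noteq> 0" "A * p + B * q = [:c:]"
        using min_relation_bezout[OF q p] by blast
      then have "h c \<noteq> 0" using inj by blast
      then show ?thesis using min_relation_nonzero[OF AB(1,2) p(1) qp(1) AB(5) _ \<xi>] by blast
    qed
    then show ?thesis using min_relation_specialize[OF q nz \<xi>] by blast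
  next
    case False
    have "|h ` S| \<le>o r" by (intro image_le S)
    then obtain \<xi> where \<xi>: "\<And>p. p \<in> polys_over (h ` S) \<Longrightarrow> p \<noteq> 0 \<Longrightarrow> poly p \<xi> \<noteq> 0"
      using ex_transcendental assms(3) by blast
    have "p = 0" if p: "p \<in> polys" "poly (map_poly h p) \<xi> = 0" for p
    proof -
      have "map_poly h p \<in> polys_over (h ` S)"
        using p(1) by (auto simp: polys_over_def coeff_map_poly)
      with \<xi> p(2) have "map_poly h p = 0" by blast
      then have "h (coeff p i) = 0" for i by (metis coeff_map_poly coeff_0 h_zero)
      then show "p = 0" using inj coeff_polys[OF p(1)] by (auto intro: poly_eqI)
    qed
    with False show ?thesis by (intro exI[of _ \<xi>]) (metis map_poly_0 poly_0)
  qed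
  then obtain \<xi> where \<xi>: "\<And>p. p \<in> polys \<Longrightarrow> poly p x = 0 \<longleftrightarrow> poly (map_poly h p) \<xi> = 0" by blast
  then obtain h' where h': "subring_hom (adjoin S x) h'"
    "\<And>p. p \<in> polys \<Longrightarrow> h' (poly p x) = poly (map_poly h p) \<xi>"
    "\<And>s. s \<in> S \<Longrightarrow> h' s = h s"
    using extend_adjoin by blast
  moreover have "u = 0" if "u \<in> adjoin S x" "h' u = 0" for u
    using that \<xi> h'(2) by (auto simp: adjoin_def)
  ultimately show ?thesis by blast
qed

text \<open>Unlike the finite statement, this one keeps only the few scalars in \<open>C\<close> fixed. The subring \<open>R\<close> they generate
  together with \<open>Z\<close> is smaller than \<open>K\<close>, so a maximal injective homomorphism defined on a part of \<open>R\<close> is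
  defined on all of it. Homomorphisms are represented by their graphs, for which chains have unions;
  the last clause of \<open>good\<close> says both that the graph is single-valued and that it is injective.\<close>

lemma ex_specialization_infinite:
  fixes \<iota> :: "'k::alg_closed_field \<Rightarrow> 'f::field"
  assumes emb: "field_embedding \<iota>" and Z: "|Z| \<le>o r" and C: "|C| \<le>o r"
    and K: "r <o |UNIV :: 'k set|"
  shows "\<exists>S h. subring_hom S h \<and> \<iota> ` C \<union> Z \<subseteq> S \<and> (\<forall>c\<in>C. h (\<iota> c) = c)"
proof -
  have "|\<iota> ` C \<union> Z| \<le>o r" by (intro Un_le image_le Z C)
  then obtain R where "subring R" and R: "\<iota> ` C \<union> Z \<subseteq> R" "|R| \<le>o r"
    using ex_subring_le by blast
  interpret R: subring R by fact
  define good :: "('f \<times> 'k) set \<Rightarrow> bool" where "good G \<longleftrightarrow> fst ` G \<subseteq> R \<and> (\<forall>c. \<iota> c \<in> R \<longrightarrow> (\<iota> c, c) \<in> G) \<and>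
    (\<forall>x y x' y'. (x, y) \<in> G \<longrightarrow> (x', y') \<in> G \<longrightarrow> (x - x', y - y') \<in> G \<and> (x * x', y * y') \<in> G) \<and>
    (\<forall>x y. (x, y) \<in> G \<longrightarrow> (x = 0 \<longleftrightarrow> y = 0))" for G
  interpret E: subring_hom "range \<iota>" "inv \<iota>" by (rule subring_hom_inv_embedding[OF emb])
  have \<iota>: "\<iota> 1 = 1" "\<iota> (x - y) = \<iota> x - \<iota> y" "\<iota> (x * y) = \<iota> x * \<iota> y" "\<iota> x = 0 \<longleftrightarrow> x = 0" for x y
    by (rule field_embedding_simps[OF emb])+
  \<comment> \<open>The search for a maximal graph starts from the scalars that lie in R.\<close>
  have "good {(\<iota> c, c) |c. \<iota> c \<in> R}"
    unfolding good_def
    by (auto simp: \<iota>(2-4) R.diff_mem R.mult_mem)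
  then have "{G. good G} \<noteq> {}" by blast
  moreover have "\<Union>\<C> \<in> {G. good G}" if "\<C> \<noteq> {}" "subset.chain {G. good G} \<C>" for \<C>
  proof -
    have g: "good G" if "G \<in> \<C>" for G
      using that \<open>subset.chain _ _\<close> by (auto simp: subset.chain_def)
    have tot: "G \<subseteq> H \<or> H \<subseteq> G" if "G \<in> \<C>" "H \<in> \<C>" for G H
      using that \<open>subset.chain _ _\<close> by (auto simp: subset.chain_def)
    have closed: "(x - x', y - y') \<in> \<Union>\<C> \<and> (x * x', y * y') \<in> \<Union>\<C>"
      if "(x, y) \<in> \<Union>\<C>" "(x', y') \<in> \<Union>\<C>" for x y x' y'
    proof -
      from that obtain G H where *: "G \<in> \<C>" "H \<in> \<C>" "(x, y) \<in> G" "(x', y') \<in> H" by blast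
      with tot[of G H] obtain M where "M \<in> \<C>" "(x, y) \<in> M" "(x', y') \<in> M" by blast
      with g[of M] show ?thesis unfolding good_def by blast
    qed
    have "fst ` G \<subseteq> R" if "G \<in> \<C>" for G
      using g[OF that] unfolding good_def by (rule conjunct1)
    then have "fst ` (\<Union>\<C>) \<subseteq> R" by blast
    moreover have "(\<iota> c, c) \<in> \<Union>\<C>" if "\<iota> c \<in> R" for c
    proof -
      obtain G where "G \<in> \<C>" using \<open>\<C> \<noteq> {}\<close> by blast
      with g[of G] that show ?thesis unfolding good_def by blast
    qed
    moreover have "x = 0 \<longleftrightarrow> y = 0" if xy: "(x, y) \<in> \<Union>\<C>" for x y
    proof -
      obtain G where "G \<in> \<C>" "(x, y) \<in> G" using xy by blast
      with g[of G] show ?thesis unfolding good_def by blast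
    qed
    ultimately show ?thesis
      unfolding good_def mem_Collect_eq using closed by (intro conjI allI impI) simp_all
  qed
  ultimately have "\<exists>G\<in>{G. good G}. \<forall>H\<in>{G. good G}. G \<subseteq> H \<longrightarrow> H = G"
    by (rule subset_Zorn_nonempty)
  then obtain G where G: "good G" and max: "\<And>H. good H \<Longrightarrow> G \<subseteq> H \<Longrightarrow> H = G"
    by auto
  have G_sub: "fst ` G \<subseteq> R"
    using G unfolding good_def by (elim conjE)
  have G_emb: "(\<iota> c, c) \<in> G" if "\<iota> c \<in> R" for c
    using G that unfolding good_def by (elim conjE) simp
  have G_closed: "(x - x', y - y') \<in> G" "(x * x', y * y') \<in> G" if "(x, y) \<in> G" "(x', y') \<in> G" for x y x' y'
    using G that unfolding good_def by (elim conjE; simp)+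
  have G_zero: "x = 0 \<longleftrightarrow> y = 0" if "(x, y) \<in> G" for x y
    using G that unfolding good_def by (elim conjE) simp
  define S where "S = fst ` G"
  define h where "h x = (THE y. (x, y) \<in> G)" for x
  have uniq: "y = y'" if "(x, y) \<in> G" "(x, y') \<in> G" for x y y'
    using G_zero[OF G_closed(1)[OF that]] by simp
  have h: "h x = y" if "(x, y) \<in> G" for x y
    unfolding h_def using that by (rule the_equality) (rule uniq[OF _ that])
  have mem: "(x, h x) \<in> G" if "x \<in> S" for x
  proof -
    from that obtain y where "(x, y) \<in> G" by (auto simp: S_def)
    with h show ?thesis by metis
  qed
  have fst_mem: "x \<in> S" if "(x, y) \<in> G" for x y
    using that unfolding S_def by (metis fst_conv image_eqI)
  have one: "(1, 1) \<in> G" using G_emb[of 1] \<iota>(1) R.one_mem by simp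
  have "subring_hom S h"
  proof
    show "1 \<in> S" "h 1 = 1" using fst_mem[OF one] h[OF one] by auto
  next
    fix x y assume "x \<in> S" "y \<in> S"
    then have *: "(x - y, h x - h y) \<in> G" "(x * y, h x * h y) \<in> G"
      by (simp_all add: G_closed mem)
    show "x - y \<in> S" "x * y \<in> S" "h (x - y) = h x - h y" "h (x * y) = h x * h y"
      using *[THEN fst_mem] *[THEN h] by auto
  qed
  then interpret H: subring_hom S h .
  have SR: "S \<subseteq> R" using G_sub by (simp add: S_def)
  have inj: "u = 0" if "u \<in> S" "h u = 0" for u
    using G_zero[OF mem[OF that(1)]] that(2) by simp
  have "x \<in> S" if "x \<in> R" for x
  proof -
    obtain h' where h': "subring_hom (adjoin S x) h'" "\<forall>s\<in>S. h' s = h s"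
      "\<forall>u\<in>adjoin S x. h' u = 0 \<longrightarrow> u = 0"
      using extend_injective_hom[OF \<open>subring_hom S h\<close> mono_le[OF SR R(2)] K inj] by blast
    interpret H': subring_hom "adjoin S x" h' by fact
    define G' where "G' = (\<lambda>u. (u, h' u)) ` adjoin S x"
    have "G \<subseteq> G'"
    proof
      fix z assume "z \<in> G"
      then have "fst z \<in> S" "z = (fst z, h (fst z))" using h[of "fst z" "snd z"] by (auto simp: S_def)
      then have "z = (fst z, h' (fst z))" "fst z \<in> adjoin S x"
        using h'(2) H.subset_adjoin by auto
      then show "z \<in> G'" unfolding G'_def by (rule image_eqI)
    qed
    moreover have "adjoin S x \<subseteq> R"
      using SR that by (auto simp: adjoin_def polys_over_def poly_altdef intro!: R.sum_mem R.mult_mem R.power_mem)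
    then have "good G'"
      unfolding good_def
    proof (intro conjI allI impI)
      show "fst ` G' \<subseteq> R" using \<open>adjoin S x \<subseteq> R\<close> by (auto simp: G'_def)
      show "(\<iota> c, c) \<in> G'" if "\<iota> c \<in> R" for c
        using G_emb[OF that] \<open>G \<subseteq> G'\<close> by blast
    qed (use h'(3) in \<open>auto simp: G'_def H'.h_diff H'.h_mult H'.diff_mem H'.mult_mem\<close>)
    ultimately have "G' = G" using max by blast
    then show ?thesis using H.mem_adjoin fst_mem unfolding G'_def by blast
  qed
  then have "\<iota> ` C \<union> Z \<subseteq> S" using R(1) by blast
  moreover have "h (\<iota> c) = c" if "c \<in> C" for c
    using R(1) that by (intro h G_emb) blast
  ultimately show ?thesis using H.subring_hom_axioms by blast
qed

end

section \<open>Isomorphisms of scalar extensions\<close>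

text \<open>Isomorphisms of scalar extensions are handled through maps \<open>g\<close> on representatives, where all laws hold
  modulo the tensor relations. This removes the quotient from the rest of the argument.\<close>

definition lifts_isomorphism where
  "lifts_isomorphism scaleA multA scaleB multB \<iota> g \<longleftrightarrow>
    (\<forall>x y. (x, y) \<in> tensor_cong scaleA \<iota> \<longleftrightarrow> (g x, g y) \<in> tensor_cong scaleB \<iota>) \<and>
    (\<forall>z. \<exists>x. (g x, z) \<in> tensor_cong scaleB \<iota>) \<and>
    (\<forall>x y. (g (x + y), g x + g y) \<in> tensor_cong scaleB \<iota>) \<and>
    (\<forall>c x. (g (pre_smult c x), pre_smult c (g x)) \<in> tensor_cong scaleB \<iota>) \<and>
    (\<forall>x y. (g (pre_mult multA x y), pre_mult multB (g x) (g y)) \<in> tensor_cong scaleB \<iota>)"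

lemma lifts_isomorphismD:
  assumes "lifts_isomorphism scaleA multA scaleB multB \<iota> g"
  shows "(x, y) \<in> tensor_cong scaleA \<iota> \<longleftrightarrow> (g x, g y) \<in> tensor_cong scaleB \<iota>"
    and "\<exists>x. (g x, z) \<in> tensor_cong scaleB \<iota>"
    and "(g (x + y), g x + g y) \<in> tensor_cong scaleB \<iota>"
    and "(g (pre_smult c x), pre_smult c (g x)) \<in> tensor_cong scaleB \<iota>"
    and "(g (pre_mult multA x y), pre_mult multB (g x) (g y)) \<in> tensor_cong scaleB \<iota>"
  using assms unfolding lifts_isomorphism_def by (elim conjE; simp only: simp_thms)+

context nonassoc_algebra
begin

lemma scalar_extension_simps:
  fixes \<iota> :: "'k \<Rightarrow> 'f::field"
  defines "R \<equiv> tensor_cong scale \<iota>" and "E \<equiv> scalar_extension scale mul \<iota>"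
  shows "alg_carrier E = UNIV // R"
    "alg_add E (R `` {x}) (R `` {y}) = R `` {x + y}"
    "alg_smult E c (R `` {x}) = R `` {pre_smult c x}"
    "alg_mult E (R `` {x}) (R `` {y}) = R `` {pre_mult mul x y}"
proof -
  have eqv: "equiv UNIV R" unfolding R_def by (rule equiv_tensor_cong)
  have cls: "R `` {x} = R `` {y}" if "(x, y) \<in> R" for x y
    using equiv_class_eq[OF eqv that] .
  show "alg_carrier E = UNIV // R" by (simp add: E_def R_def scalar_extension_def Let_def)
  have "(\<lambda>a b. R `` {a + b}) respects2 R"
    by (intro congruent2I' cls) (simp add: R_def tensor_cong_add)
  then have "(\<Union>a\<in>R `` {x}. \<Union>b\<in>R `` {y}. R `` {a + b}) = R `` {x + y}"
    by (intro UN_equiv_class2[OF eqv eqv]) simp_all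
  then show "alg_add E (R `` {x}) (R `` {y}) = R `` {x + y}"
    by (simp add: E_def R_def scalar_extension_def Let_def)
  have "(\<lambda>a. R `` {pre_smult c a}) respects R"
    by (intro congruentI cls) (simp add: R_def pre_smult_cong)
  then have "(\<Union>a\<in>R `` {x}. R `` {pre_smult c a}) = R `` {pre_smult c x}"
    by (intro UN_equiv_class[OF eqv]) simp_all
  then show "alg_smult E c (R `` {x}) = R `` {pre_smult c x}"
    by (simp add: E_def R_def scalar_extension_def Let_def)
  have "(\<lambda>a b. R `` {pre_mult mul a b}) respects2 R"
    by (intro congruent2I' cls) (simp add: R_def pre_mult_cong)
  then have "(\<Union>a\<in>R `` {x}. \<Union>b\<in>R `` {y}. R `` {pre_mult mul a b}) = R `` {pre_mult mul x y}"
    by (intro UN_equiv_class2[OF eqv eqv]) simp_all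
  then show "alg_mult E (R `` {x}) (R `` {y}) = R `` {pre_mult mul x y}"
    by (simp add: E_def R_def scalar_extension_def Let_def)
qed

end

lemma algebra_isomorphic_iff_lifts:
  fixes \<iota> :: "'k::field \<Rightarrow> 'f::field"
  assumes A: "nonassoc_algebra scaleA multA" and B: "nonassoc_algebra scaleB multB"
  shows "algebra_isomorphic (scalar_extension scaleA multA \<iota>) (scalar_extension scaleB multB \<iota>) \<longleftrightarrow>
    (\<exists>g. lifts_isomorphism scaleA multA scaleB multB \<iota> g)"
proof -
  interpret A: nonassoc_algebra scaleA multA by fact
  interpret B: nonassoc_algebra scaleB multB by fact
  define R where "R = tensor_cong scaleA \<iota>"
  define T where "T = tensor_cong scaleB \<iota>"
  let ?E = "scalar_extension scaleA multA \<iota>" and ?G = "scalar_extension scaleB multB \<iota>"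
  note E = A.scalar_extension_simps[of \<iota>, folded R_def]
  note G = B.scalar_extension_simps[of \<iota>, folded T_def]
  have Req: "equiv UNIV R" and Teq: "equiv UNIV T"
    unfolding R_def T_def by (rule equiv_tensor_cong)+
  have Rcls: "R `` {x} = R `` {y} \<longleftrightarrow> (x, y) \<in> R" for x y
    using eq_equiv_class_iff[OF Req] by simp
  have Tcls: "T `` {x} = T `` {y} \<longleftrightarrow> (x, y) \<in> T" for x y
    using eq_equiv_class_iff[OF Teq] by simp
  have R: "R `` {x} \<in> UNIV // R" and T: "T `` {y} \<in> UNIV // T" for x y
    by (rule quotientI, simp)+
  have Rex: "\<exists>x. X = R `` {x}" if "X \<in> UNIV // R" for X using that by (auto elim: quotientE)
  have Tex: "\<exists>y. Y = T `` {y}" if "Y \<in> UNIV // T" for Y using that by (auto elim: quotientE)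
  show ?thesis
  proof
    assume "algebra_isomorphic ?E ?G"
    then obtain \<phi> where bij: "bij_betw \<phi> (UNIV // R) (UNIV // T)"
      and add: "\<forall>X\<in>UNIV // R. \<forall>Y\<in>UNIV // R. \<phi> (alg_add ?E X Y) = alg_add ?G (\<phi> X) (\<phi> Y)"
      and smult: "\<forall>c. \<forall>X\<in>UNIV // R. \<phi> (alg_smult ?E c X) = alg_smult ?G c (\<phi> X)"
      and mult: "\<forall>X\<in>UNIV // R. \<forall>Y\<in>UNIV // R. \<phi> (alg_mult ?E X Y) = alg_mult ?G (\<phi> X) (\<phi> Y)"
      unfolding algebra_isomorphic_def E(1) G(1) by (elim exE conjE)
    have "\<exists>z. \<phi> (R `` {x}) = T `` {z}" for x
      by (rule Tex) (use bij_betwE[OF bij] R in blast)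
    then obtain g where g: "\<And>x. \<phi> (R `` {x}) = T `` {g x}" by metis
    have "(x, y) \<in> R \<longleftrightarrow> (g x, g y) \<in> T" for x y
      using inj_on_eq_iff[OF bij_betw_imp_inj_on[OF bij] R R, of x y] by (simp add: g Rcls Tcls)
    moreover have "\<exists>x. (g x, z) \<in> T" for z
    proof -
      have "T `` {z} \<in> \<phi> ` (UNIV // R)"
        unfolding bij_betw_imp_surj_on[OF bij] by (rule T)
      then obtain X where "T `` {z} = \<phi> X" "X \<in> UNIV // R" by blast
      then obtain x where "T `` {z} = \<phi> (R `` {x})" using Rex by blast
      then have "T `` {g x} = T `` {z}" by (simp add: g)
      then show ?thesis unfolding Tcls ..
    qed
    moreover have "(g (x + y), g x + g y) \<in> T" for x y
      using add[rule_format, OF R R, of x y] by (simp add: E G g Tcls)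
    moreover have "(g (pre_smult c x), pre_smult c (g x)) \<in> T" for c x
      using smult[rule_format, OF R, of c x] by (simp add: E G g Tcls)
    moreover have "(g (pre_mult multA x y), pre_mult multB (g x) (g y)) \<in> T" for x y
      using mult[rule_format, OF R R, of x y] by (simp add: E G g Tcls)
    ultimately have "lifts_isomorphism scaleA multA scaleB multB \<iota> g"
      unfolding lifts_isomorphism_def R_def T_def by (intro conjI allI)
    then show "\<exists>g. lifts_isomorphism scaleA multA scaleB multB \<iota> g" by blast
  next
    assume "\<exists>g. lifts_isomorphism scaleA multA scaleB multB \<iota> g"
    then obtain g where g: "lifts_isomorphism scaleA multA scaleB multB \<iota> g" ..
    note iff = lifts_isomorphismD(1)[OF g, folded R_def T_def]
      and surj = lifts_isomorphismD(2)[OF g, folded T_def]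
      and ops = lifts_isomorphismD(3-5)[OF g, folded T_def]
    define \<phi> where "\<phi> X = (\<Union>x\<in>X. T `` {g x})" for X
    have "(\<lambda>x. T `` {g x}) respects R"
      by (rule congruentI) (simp only: Tcls iff)
    then have \<phi>: "\<phi> (R `` {x}) = T `` {g x}" for x
      unfolding \<phi>_def by (intro UN_equiv_class[OF Req]) simp_all
    have "bij_betw \<phi> (UNIV // R) (UNIV // T)"
    proof (rule bij_betw_imageI)
      show "inj_on \<phi> (UNIV // R)"
      proof (rule inj_onI)
        fix X Y assume "X \<in> UNIV // R" "Y \<in> UNIV // R" and eq: "\<phi> X = \<phi> Y"
        then obtain x y where "X = R `` {x}" "Y = R `` {y}" by (meson Rex)
        with eq show "X = Y" by (simp only: \<phi> Tcls Rcls iff)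
      qed
      show "\<phi> ` (UNIV // R) = UNIV // T"
      proof (intro subset_antisym subsetI)
        fix Y assume "Y \<in> UNIV // T"
        then obtain z where z: "Y = T `` {z}" using Tex by blast
        obtain x where "(g x, z) \<in> T" using surj by blast
        then have "Y = \<phi> (R `` {x})" by (simp add: z \<phi> Tcls[symmetric])
        then show "Y \<in> \<phi> ` (UNIV // R)" using R by (rule image_eqI)
      next
        fix Y assume "Y \<in> \<phi> ` (UNIV // R)"
        then obtain X where "Y = \<phi> X" "X \<in> UNIV // R" by blast
        then obtain x where "Y = \<phi> (R `` {x})" using Rex by blast
        then show "Y \<in> UNIV // T" using T by (simp add: \<phi>)
      qed
    qed
    then show "algebra_isomorphic ?E ?G"
      unfolding algebra_isomorphic_def E(1) G(1)
    proof (intro exI[of _ \<phi>] conjI ballI allI)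
      fix X Y c assume "X \<in> UNIV // R" "Y \<in> UNIV // R"
      then obtain x y where [simp]: "X = R `` {x}" "Y = R `` {y}" by (meson Rex)
      show "\<phi> (alg_add ?E X Y) = alg_add ?G (\<phi> X) (\<phi> Y)"
        "\<phi> (alg_mult ?E X Y) = alg_mult ?G (\<phi> X) (\<phi> Y)"
        by (simp_all add: E G \<phi> Tcls ops)
      show "\<phi> (alg_smult ?E c X) = alg_smult ?G c (\<phi> X)"
        by (simp add: E G \<phi> Tcls ops)
    qed
  qed
qed

lemma tensor_cong_equiv:
  "(x, x) \<in> tensor_cong scale \<iota>"
  "(x, y) \<in> tensor_cong scale \<iota> \<Longrightarrow> (y, x) \<in> tensor_cong scale \<iota>"
  "(x, y) \<in> tensor_cong scale \<iota> \<Longrightarrow> (y, z) \<in> tensor_cong scale \<iota> \<Longrightarrow> (x, z) \<in> tensor_cong scale \<iota>"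
  using equiv_tensor_cong[of scale \<iota>] unfolding equiv_def
  by (meson UNIV_I refl_onD symD transD)+

text \<open>An arbitrary choice of preimages will do: since \<open>g\<close> reflects the congruence, each law for \<open>g'\<close> can be
  checked after applying \<open>g\<close>.\<close>

lemma lifts_isomorphism_inverse:
  fixes scaleA :: "'k::field \<Rightarrow> 'a::ab_group_add \<Rightarrow> 'a" and scaleB :: "'k \<Rightarrow> 'b::ab_group_add \<Rightarrow> 'b"
    and \<iota> :: "'k \<Rightarrow> 'f::field"
  assumes A: "nonassoc_algebra scaleA multA" and B: "nonassoc_algebra scaleB multB"
    and g: "lifts_isomorphism scaleA multA scaleB multB \<iota> g"
  obtains g' where "lifts_isomorphism scaleB multB scaleA multA \<iota> g'"
    "\<And>x. (g' (g x), x) \<in> tensor_cong scaleA \<iota>" "\<And>z. (g (g' z), z) \<in> tensor_cong scaleB \<iota>"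
proof -
  interpret A: nonassoc_algebra scaleA multA by fact
  interpret B: nonassoc_algebra scaleB multB by fact
  define T where "T = tensor_cong scaleB \<iota>"
  note sym = tensor_cong_equiv(2)[of _ _ scaleB \<iota>, folded T_def]
  note trans = tensor_cong_equiv(3)[of _ _ scaleB \<iota>, folded T_def]
  note iff = lifts_isomorphismD(1)[OF g, folded T_def]
    and surj = lifts_isomorphismD(2)[OF g, folded T_def]
    and add = lifts_isomorphismD(3)[OF g, folded T_def]
    and smult = lifts_isomorphismD(4)[OF g, folded T_def]
    and mult = lifts_isomorphismD(5)[OF g, folded T_def]
  from surj obtain g' where g': "\<And>z. (g (g' z), z) \<in> T" by metis
  have left: "(g' (g x), x) \<in> tensor_cong scaleA \<iota>" for x
    unfolding iff by (rule g')
  have "lifts_isomorphism scaleB multB scaleA multA \<iota> g'"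
    unfolding lifts_isomorphism_def iff T_def[symmetric]
  proof (intro conjI allI)
    fix x y c
    show "(x, y) \<in> T \<longleftrightarrow> (g (g' x), g (g' y)) \<in> T"
      using g' sym trans by meson
    show "\<exists>x. (g (g' x), g z) \<in> T" for z
      using g' by blast
    have "(g (g' x) + g (g' y), x + y) \<in> T"
      using g' tensor_cong_add unfolding T_def by blast
    then show "(g (g' (x + y)), g (g' x + g' y)) \<in> T"
      using g' add sym trans by meson
    have "(pre_smult c (g (g' x)), pre_smult c x) \<in> T"
      using g' pre_smult_cong unfolding T_def by blast
    then show "(g (g' (pre_smult c x)), g (pre_smult c (g' x))) \<in> T"
      using g' smult sym trans by meson
    have "(pre_mult multB (g (g' x)) (g (g' y)), pre_mult multB x y) \<in> T"
      using g' B.pre_mult_cong unfolding T_def by blast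
    then show "(g (g' (pre_mult multB x y)), g (pre_mult multA (g' x) (g' y))) \<in> T"
      using g' mult sym trans by meson
  qed
  with left g' that show ?thesis unfolding T_def by blast
qed

definition linear_algebra_iso where
  "linear_algebra_iso scaleA multA scaleB multB \<psi> \<longleftrightarrow> bij \<psi> \<and> Vector_Spaces.linear scaleA scaleB \<psi> \<and>
    (\<forall>x y. \<psi> (multA x y) = multB (\<psi> x) (\<psi> y))"

lemma frag_extend_tensor_cong:
  fixes \<iota> :: "'k::field \<Rightarrow> 'f::field"
  assumes lin: "Vector_Spaces.linear scaleA scaleB \<psi>" and xy: "(x, y) \<in> tensor_cong scaleA \<iota>"
  defines "g \<equiv> frag_extend (\<lambda>(a, f::'f). frag_of (\<psi> a, f))"
  shows "(g x, g y) \<in> tensor_cong scaleB \<iota>"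
proof -
  have \<psi>: "\<psi> (a + b) = \<psi> a + \<psi> b" "\<psi> (scaleA c a) = scaleB c (\<psi> a)" for a b c
    using lin by (simp_all add: Vector_Spaces.linear_iff)
  have "g r \<in> tensor_relators scaleB \<iota>" if "r \<in> tensor_relators scaleA \<iota>" for r
    using that
    by (cases rule: tensor_relators_cases)
       (simp_all add: g_def frag_extend_diff \<psi> tensor_relators_intros)
  then have "g r \<in> group_closure (tensor_relators scaleB \<iota>)" if "r \<in> tensor_relators scaleA \<iota>" for r
    using that by (intro group_closure.base insertI2)
  moreover have "x - y \<in> group_closure (tensor_relators scaleA \<iota>)"
    using xy by (simp add: tensor_cong_def)
  ultimately have "g (x - y) \<in> group_closure (tensor_relators scaleB \<iota>)"
    unfolding g_def by (rule frag_extend_closure)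
  then show ?thesis by (simp add: g_def tensor_cong_def frag_extend_diff)
qed

text \<open>Base change: \<open>\<psi> \<otimes> id\<close> satisfies all laws exactly, already on representatives.\<close>

lemma lifts_of_linear_algebra_iso:
  fixes \<iota> :: "'k::field \<Rightarrow> 'f::field"
  assumes "linear_algebra_iso scaleA multA scaleB multB \<psi>"
  shows "lifts_isomorphism scaleA multA scaleB multB \<iota> (frag_extend (\<lambda>(a, f). frag_of (\<psi> a, f)))"
proof -
  have bij: "bij \<psi>" and lin: "Vector_Spaces.linear scaleA scaleB \<psi>"
    and mult: "\<And>x y. \<psi> (multA x y) = multB (\<psi> x) (\<psi> y)"
    using assms by (auto simp: linear_algebra_iso_def)
  define g where "g = frag_extend (\<lambda>(a, f::'f). frag_of (\<psi> a, f))"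
  define g' where "g' = frag_extend (\<lambda>(b, f::'f). frag_of (inv \<psi> b, f))"
  have lin': "Vector_Spaces.linear scaleB scaleA (inv \<psi>)"
  proof -
    interpret Vector_Spaces.linear scaleA scaleB \<psi> by fact
    have [simp]: "\<psi> (inv \<psi> b) = b" "inv \<psi> (\<psi> a) = a" for a b
      using bij by (simp_all add: bij_is_inj bij_is_surj surj_f_inv_f)
    have "inv \<psi> (b + b') = inv \<psi> (\<psi> (inv \<psi> b + inv \<psi> b'))" for b b'
      unfolding add by simp
    moreover have "inv \<psi> (scaleB c b) = inv \<psi> (\<psi> (scaleA c (inv \<psi> b)))" for b c
      unfolding scale by simp
    ultimately show ?thesis
      by unfold_locales simp_all
  qed
  have g'g: "g' (g x) = x" for x
    using subset_UNIV
    by (induction x rule: frag_induction)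
       (auto simp: g_def g'_def frag_extend_diff bij_is_inj[OF bij])
  have gg': "g (g' z) = z" for z
    using subset_UNIV
    by (induction z rule: frag_induction)
       (auto simp: g_def g'_def frag_extend_diff surj_f_inv_f[OF bij_is_surj[OF bij]])
  have smult: "g (pre_smult c x) = pre_smult c (g x)" for c x
    using subset_UNIV
    by (induction x rule: frag_induction) (auto simp: g_def pre_smult_def frag_extend_diff)
  have mult1: "g (pre_mult multA (frag_of p) y) = pre_mult multB (g (frag_of p)) (g y)" for p y
    using subset_UNIV
    by (induction y rule: frag_induction)
       (auto simp: g_def pre_mult_def frag_extend_diff mult split: prod.split)
  have g_diff: "g (u - v) = g u - g v" for u v by (simp add: g_def frag_extend_diff)
  have mult: "g (pre_mult multA x y) = pre_mult multB (g x) (g y)" for x y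
    using subset_UNIV
  proof (induction x rule: frag_induction)
    case zero
    then show ?case by (simp add: g_def pre_mult_def)
  qed (simp_all add: mult1 g_diff pre_mult_diff_left)
  have cong: "(g x, g y) \<in> tensor_cong scaleB \<iota>" if "(x, y) \<in> tensor_cong scaleA \<iota>" for x y
    unfolding g_def by (rule frag_extend_tensor_cong[OF lin that])
  have cong': "(g' x, g' y) \<in> tensor_cong scaleA \<iota>" if "(x, y) \<in> tensor_cong scaleB \<iota>" for x y
    unfolding g'_def by (rule frag_extend_tensor_cong[OF lin' that])
  have "(x, y) \<in> tensor_cong scaleA \<iota> \<longleftrightarrow> (g x, g y) \<in> tensor_cong scaleB \<iota>" for x y
    using cong cong'[of "g x" "g y"] by (auto simp: g'g)
  moreover have "g (x + y) = g x + g y" for x y by (simp add: g_def frag_extend_add)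
  ultimately have "lifts_isomorphism scaleA multA scaleB multB \<iota> g"
    unfolding lifts_isomorphism_def smult mult using gg' tensor_cong_equiv(1) by metis
  then show ?thesis unfolding g_def .
qed

lemma pre_mult_add:
  "pre_mult mul (u + v) w = pre_mult mul u w + pre_mult mul v w"
  "pre_mult mul w (u + v) = pre_mult mul w u + pre_mult mul w v"
  by (simp add: pre_mult_def frag_extend_add) (simp add: pre_mult_swap frag_extend_add)

lemma pre_mult_diff_right: "pre_mult mul w (u - v) = pre_mult mul w u - pre_mult mul w v"
  by (simp add: pre_mult_swap frag_extend_diff)

lemma pre_smult_diff: "pre_smult c (u - v) = pre_smult c u - pre_smult c v"
  by (simp add: pre_smult_def frag_extend_diff)

lemma pre_mult_smult_left: "pre_mult mul (pre_smult c x) y = pre_smult c (pre_mult mul x y)"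
proof -
  have *: "pre_mult mul (pre_smult c (frag_of p)) y = pre_smult c (pre_mult mul (frag_of p) y)" for p
    using subset_UNIV
    by (induction y rule: frag_induction)
       (auto simp: pre_mult_def pre_smult_def frag_extend_diff mult.assoc split: prod.split)
  show ?thesis
    using subset_UNIV
  proof (induction x rule: frag_induction)
    case zero
    then show ?case by (simp add: pre_mult_def pre_smult_def)
  qed (simp_all add: * pre_smult_diff pre_mult_diff_left)
qed

lemma pre_mult_smult_right: "pre_mult mul x (pre_smult c y) = pre_smult c (pre_mult mul x y)"
proof -
  have *: "pre_mult mul x (pre_smult c (frag_of p)) = pre_smult c (pre_mult mul x (frag_of p))" for p
    using subset_UNIV
    by (induction x rule: frag_induction)
       (auto simp: pre_mult_def pre_smult_def frag_extend_diff mult.left_commute split: prod.split)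
  show ?thesis
    using subset_UNIV
  proof (induction y rule: frag_induction)
    case zero
    then show ?case by (simp add: pre_mult_swap pre_smult_def)
  qed (simp_all add: * pre_smult_diff pre_mult_diff_right)
qed

locale based_algebra = nonassoc_algebra scale mul
  for scale :: "'k::field \<Rightarrow> 'a::ab_group_add \<Rightarrow> 'a" and mul +
  fixes B :: "'a set"
  assumes indep: "independent B" and spanning: "span B = UNIV"
begin

abbreviation rep :: "'a \<Rightarrow> 'a \<Rightarrow> 'k" where
  "rep \<equiv> representation B"

lemma rep_add: "rep (x + y) b = rep x b + rep y b"
  using representation_add[OF indep] spanning by simp

lemma rep_scale: "rep (scale c x) b = c * rep x b"
  using representation_scale[OF indep] spanning by simp

lemma rep_sum: "rep (sum v I) b = (\<Sum>i\<in>I. rep (v i) b)"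
  using representation_sum[OF indep, of I v] spanning by simp

lemma rep_basis: "a \<in> B \<Longrightarrow> rep a b = (if b = a then 1 else 0)"
  using representation_basis[OF indep] by simp

lemma rep_expand: "(\<Sum>b | rep x b \<noteq> 0. scale (rep x b) b) = x"
  using sum_nonzero_representation_eq[OF indep] spanning by simp

lemma rep_eqI:
  assumes "\<And>b. b \<in> B \<Longrightarrow> rep x b = rep y b" shows "x = y"
proof -
  have "rep x b = rep y b" for b
  proof (cases "b \<in> B")
    case False
    then have "rep x b = 0" "rep y b = 0" using representation_ne_zero[of B _ b] by blast+
    then show ?thesis by simp
  qed (rule assms)
  then have eq: "rep x = rep y" by (rule ext)
  have "x = (\<Sum>b | rep x b \<noteq> 0. scale (rep x b) b)" by (simp only: rep_expand)
  also have "\<dots> = y" unfolding eq by (rule rep_expand)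
  finally show ?thesis .
qed

end

locale based_extension = based_algebra scale mul B
  for scale :: "'k::field \<Rightarrow> 'a::ab_group_add \<Rightarrow> 'a" and mul B +
  fixes \<iota> :: "'k \<Rightarrow> 'f::field"
  assumes emb: "field_embedding \<iota>"
begin

text \<open>The coordinate of \<open>a \<otimes> f\<close> at \<open>b\<close> is the coefficient of \<open>a\<close> at \<open>b\<close> times \<open>f\<close>, extended additively.\<close>

definition coord :: "'a \<Rightarrow> ('a \<times> 'f \<Rightarrow>\<^sub>0 int) \<Rightarrow> 'f" where
  "coord b x = (\<Sum>p\<in>Poly_Mapping.keys x.
     of_int (Poly_Mapping.lookup x p) * (\<iota> (rep (fst p) b) * snd p))"

lemma coord_frag_of [simp]: "coord b (frag_of (a, f)) = \<iota> (rep a b) * f"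
  by (simp add: coord_def)

lemma coord_superset:
  assumes "finite P" "Poly_Mapping.keys x \<subseteq> P"
  shows "coord b x = (\<Sum>p\<in>P. of_int (Poly_Mapping.lookup x p) * (\<iota> (rep (fst p) b) * snd p))"
  unfolding coord_def by (rule sum.mono_neutral_left) (use assms in \<open>auto simp: in_keys_iff\<close>)

lemma coord_diff: "coord b (x - y) = coord b x - coord b y"
proof -
  let ?P = "Poly_Mapping.keys x \<union> Poly_Mapping.keys y"
  have "coord b z = (\<Sum>p\<in>?P. of_int (Poly_Mapping.lookup z p) * (\<iota> (rep (fst p) b) * snd p))"
    if "z \<in> {x, y, x - y}" for z
    by (rule coord_superset) (use that keys_diff[of x y] in auto)
  then show ?thesis
    by (simp add: lookup_minus left_diff_distrib sum_subtractf)
qed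

lemma coord_zero [simp]: "coord b 0 = 0"
  by (simp add: coord_def)

lemma coord_add: "coord b (x + y) = coord b x + coord b y"
  using coord_diff[of b "x + y" y] by simp

lemma coord_cong:
  assumes "(x, y) \<in> tensor_cong scale \<iota>"
  shows "coord b x = coord b y"
proof -
  note \<iota> = field_embedding_simps[OF emb]
  have "coord b z = 0" if "z \<in> group_closure (tensor_relators scale \<iota>)" for z
    using that
  proof induction
    case (base s)
    then show ?case
      by (auto elim!: tensor_relators_cases simp: coord_diff coord_add rep_add rep_scale \<iota>(2,4) algebra_simps)
  qed (simp add: coord_diff)
  from this[of "x - y"] assms show ?thesis by (simp add: tensor_cong_def coord_diff)
qed

lemma coord_smult: "coord b (pre_smult c x) = c * coord b x"
  using subset_UNIV
  by (induction x rule: frag_induction)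
     (auto simp: pre_smult_def frag_extend_diff coord_diff algebra_simps)

lemma coord_outside: "b \<notin> B \<Longrightarrow> coord b x = 0"
  using representation_ne_zero field_embedding_simps(5)[OF emb]
  unfolding coord_def by (metis (no_types, lifting) mult_zero_left mult_zero_right sum.neutral)

lemma finite_coord: "finite {b. coord b x \<noteq> 0}"
proof (rule finite_subset)
  show "{b. coord b x \<noteq> 0} \<subseteq> (\<Union>p\<in>Poly_Mapping.keys x. {b. rep (fst p) b \<noteq> 0})"
  proof
    fix b assume "b \<in> {b. coord b x \<noteq> 0}"
    moreover have "coord b x = 0" if "\<forall>p\<in>Poly_Mapping.keys x. rep (fst p) b = 0"
      unfolding coord_def by (rule sum.neutral) (use that in \<open>simp add: field_embedding_simps(5)[OF emb]\<close>)
    ultimately show "b \<in> (\<Union>p\<in>Poly_Mapping.keys x. {b. rep (fst p) b \<noteq> 0})" by blast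
  qed
qed (auto intro: finite_representation)

text \<open>The elements \<open>b \<otimes> 1\<close> span the scalar extension over \<open>F\<close>. Phrasing this through \<open>F\<close>-linear functionals
  avoids finite sums in the tensor product itself. The proof goes through generators \<open>a \<otimes> f\<close>, whose
  finite supports have no common bound; hence the expansion is first shown over all sufficiently large
  finite index sets.\<close>

lemma functional_expand:
  fixes \<kappa> :: "('a \<times> 'f \<Rightarrow>\<^sub>0 int) \<Rightarrow> 'f"
  assumes cong: "\<And>x y. (x, y) \<in> tensor_cong scale \<iota> \<Longrightarrow> \<kappa> x = \<kappa> y"
    and add: "\<And>x y. \<kappa> (x + y) = \<kappa> x + \<kappa> y"
    and smult: "\<And>c x. \<kappa> (pre_smult c x) = c * \<kappa> x"
    and I: "finite I" "{b. coord b x \<noteq> 0} \<subseteq> I"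
  shows "\<kappa> x = (\<Sum>b\<in>I. coord b x * \<kappa> (frag_of (b, 1)))"
proof -
  have zero: "\<kappa> 0 = 0" using add[of 0 0] by (metis add_0 add_cancel_left_left)
  have diff: "\<kappa> (x - y) = \<kappa> x - \<kappa> y" for x y using add[of "x - y" y] by simp
  have left: "\<kappa> (frag_of (a + a', f)) = \<kappa> (frag_of (a, f)) + \<kappa> (frag_of (a', f))" for a a' f
  proof -
    have "(frag_of (a + a', f), frag_of (a, f) + frag_of (a', f)) \<in> tensor_cong scale \<iota>"
      using tensor_relators_intros(1)[of a a' f scale \<iota>]
      by (auto simp: tensor_cong_def diff_diff_eq intro: group_closure.base)
    from cong[OF this] show ?thesis by (simp add: add)
  qed
  have scale: "\<kappa> (frag_of (scale c a, f)) = \<iota> c * \<kappa> (frag_of (a, f))" for c a f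
  proof -
    have "(frag_of (scale c a, f), frag_of (a, \<iota> c * f)) \<in> tensor_cong scale \<iota>"
      using tensor_relators_intros(3)[of scale c a f \<iota>]
      by (auto simp: tensor_cong_def intro: group_closure.base)
    from cong[OF this] smult[of "\<iota> c" "frag_of (a, f)"] show ?thesis by (simp add: pre_smult_def)
  qed
  have left0: "\<kappa> (frag_of (0, f)) = 0" for f
    using left[of 0 0 f] by (metis add_0 add_cancel_left_left)
  have lsum: "\<kappa> (frag_of (sum v J, f)) = (\<Sum>j\<in>J. \<kappa> (frag_of (v j, f)))" for v f and J :: "'a set"
    by (induction J rule: infinite_finite_induct) (simp_all add: left left0)
  have gen: "\<kappa> (frag_of (a, f)) = (\<Sum>b\<in>J. coord b (frag_of (a, f)) * \<kappa> (frag_of (b, 1)))"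
    if J: "finite J" "{b. rep a b \<noteq> 0} \<subseteq> J" for a f J
  proof -
    have "\<kappa> (frag_of (a, f)) = (\<Sum>b | rep a b \<noteq> 0. \<iota> (rep a b) * \<kappa> (frag_of (b, f)))"
      by (subst rep_expand[of a, symmetric]) (simp only: lsum scale)
    also have "\<dots> = (\<Sum>b\<in>J. \<iota> (rep a b) * \<kappa> (frag_of (b, f)))"
      using J by (intro sum.mono_neutral_left) (auto simp: field_embedding_simps(5)[OF emb])
    finally show ?thesis
      using smult[of f "frag_of (_, 1)"] by (simp add: pre_smult_def mult.assoc)
  qed
  have "\<exists>J. finite J \<and> (\<forall>I. finite I \<longrightarrow> J \<subseteq> I \<longrightarrow> \<kappa> x = (\<Sum>b\<in>I. coord b x * \<kappa> (frag_of (b, 1))))"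
    using subset_UNIV
  proof (induction x rule: frag_induction)
    case zero
    then show ?case using \<open>\<kappa> 0 = 0\<close> by auto
  next
    case (one p)
    then show ?case
      using gen[of _ "fst p" "snd p"] finite_representation[of B "fst p"]
      by (intro exI[of _ "{b. rep (fst p) b \<noteq> 0}"]) auto
  next
    case (diff u v)
    then obtain J K where "finite J" "finite K"
      "\<forall>I. finite I \<longrightarrow> J \<subseteq> I \<longrightarrow> \<kappa> u = (\<Sum>b\<in>I. coord b u * \<kappa> (frag_of (b, 1)))"
      "\<forall>I. finite I \<longrightarrow> K \<subseteq> I \<longrightarrow> \<kappa> v = (\<Sum>b\<in>I. coord b v * \<kappa> (frag_of (b, 1)))"
      by blast
    then show ?case
      using \<open>\<And>x y. \<kappa> (x - y) = \<kappa> x - \<kappa> y\<close>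
      by (intro exI[of _ "J \<union> K"]) (simp add: coord_diff left_diff_distrib sum_subtractf)
  qed
  then obtain J where J: "finite J"
    "\<And>I. finite I \<Longrightarrow> J \<subseteq> I \<Longrightarrow> \<kappa> x = (\<Sum>b\<in>I. coord b x * \<kappa> (frag_of (b, 1)))" by blast
  have "(\<Sum>b\<in>I. coord b x * \<kappa> (frag_of (b, 1))) = (\<Sum>b\<in>I \<union> J. coord b x * \<kappa> (frag_of (b, 1)))"
    using I J(1) by (intro sum.mono_neutral_left) auto
  with J(2)[of "I \<union> J"] I J(1) show ?thesis by simp
qed

lemma coord_mult:
  assumes I: "finite I" "{b. coord b x \<noteq> 0} \<subseteq> I" and J: "finite J" "{b. coord b y \<noteq> 0} \<subseteq> J"
  shows "coord b (pre_mult mul x y) =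
    (\<Sum>p\<in>I. \<Sum>q\<in>J. coord p x * coord q y * \<iota> (rep (mul p q) b))"
proof -
  have "coord b (pre_mult mul x y) = (\<Sum>p\<in>I. coord p x * coord b (pre_mult mul (frag_of (p, 1)) y))"
    by (rule functional_expand[OF _ _ _ I])
       (auto simp: pre_mult_add coord_add pre_mult_smult_left coord_smult
             intro!: coord_cong pre_mult_cong tensor_cong_equiv(1))
  moreover have "coord b (pre_mult mul (frag_of (p, 1)) y) =
      (\<Sum>q\<in>J. coord q y * coord b (pre_mult mul (frag_of (p, 1)) (frag_of (q, 1))))" for p
    by (rule functional_expand[OF _ _ _ J])
       (auto simp: pre_mult_add coord_add pre_mult_smult_right coord_smult
             intro!: coord_cong pre_mult_cong tensor_cong_equiv(1))
  ultimately show ?thesis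
    by (simp add: pre_mult_def sum_distrib_left mult.assoc)
qed

end

section \<open>Matrices and descent to the base field\<close>

lemma (in based_algebra) rep_linear:
  assumes B': "based_algebra scale' mul' B'" and lin: "Vector_Spaces.linear scale scale' \<psi>"
  shows "module.representation scale' B' (\<psi> x) b =
    (\<Sum>a | rep x a \<noteq> 0. rep x a * module.representation scale' B' (\<psi> a) b)"
proof -
  interpret B': based_algebra scale' mul' B' by fact
  interpret Vector_Spaces.linear scale scale' \<psi> by fact
  have "\<psi> x = (\<Sum>a | rep x a \<noteq> 0. scale' (rep x a) (\<psi> a))"
    by (subst rep_expand[of x, symmetric]) (simp only: sum scale)
  then show ?thesis by (simp only: B'.rep_sum B'.rep_scale)
qed

lemma (in based_algebra) rep_mult:
  "rep (mul x y) b = (\<Sum>p | rep x p \<noteq> 0. \<Sum>q | rep y q \<noteq> 0. rep x p * rep y q * rep (mul p q) b)"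
proof -
  have "rep (mul x y) b = (\<Sum>p | rep x p \<noteq> 0. rep x p * rep (mul p y) b)"
    by (rule rep_linear[OF based_algebra_axioms linear_mult_left])
  moreover have "rep (mul p y) b = (\<Sum>q | rep y q \<noteq> 0. rep y q * rep (mul p q) b)" for p
    by (rule rep_linear[OF based_algebra_axioms linear_mult_right])
  ultimately show ?thesis by (simp add: sum_distrib_left mult.assoc)
qed

lemma (in based_algebra) ex_linear_with_matrix:
  assumes B': "based_algebra scale' mul' B'"
    and fin: "\<And>a. a \<in> B \<Longrightarrow> finite {b. M a b \<noteq> 0}"
    and supp: "\<And>a b. a \<in> B \<Longrightarrow> M a b \<noteq> 0 \<Longrightarrow> b \<in> B'"
  shows "\<exists>\<psi>. Vector_Spaces.linear scale scale' \<psi> \<and>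
    (\<forall>a\<in>B. \<forall>b. module.representation scale' B' (\<psi> a) b = M a b)"
proof -
  interpret B': based_algebra scale' mul' B' by fact
  interpret vector_space_pair scale scale' ..
  define \<psi> where "\<psi> = construct B (\<lambda>a. \<Sum>b | M a b \<noteq> 0. scale' (M a b) b)"
  have "B'.rep (\<psi> a) b = M a b" if a: "a \<in> B" for a b
  proof -
    have "B'.rep (\<psi> a) b = (\<Sum>c | M a c \<noteq> 0. M a c * B'.rep c b)"
      unfolding \<psi>_def construct_basis[OF indep a] B'.rep_sum B'.rep_scale ..
    also have "\<dots> = (\<Sum>c | M a c \<noteq> 0. if b = c then M a c else 0)"
      using supp[OF a] by (intro sum.cong) (auto simp: B'.rep_basis)
    also have "\<dots> = M a b"
      using fin[OF a] by (simp add: sum.delta')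
    finally show ?thesis .
  qed
  moreover have "Vector_Spaces.linear scale scale' \<psi>"
    unfolding \<psi>_def by (rule linear_construct[OF indep])
  ultimately show ?thesis by blast
qed

text \<open>An isomorphism over \<open>K\<close> is the same as two row-finite matrices that solve a system of polynomial
  equations: they are inverse to each other, and the first one respects the multiplication tables.\<close>

lemma linear_algebra_iso_of_matrices:
  fixes scaleA :: "'k::field \<Rightarrow> 'a::ab_group_add \<Rightarrow> 'a" and scaleB :: "'k \<Rightarrow> 'b::ab_group_add \<Rightarrow> 'b"
  assumes A: "based_algebra scaleA multA BA" and B: "based_algebra scaleB multB BB"
  defines "repA \<equiv> module.representation scaleA BA" and "repB \<equiv> module.representation scaleB BB"
  assumes M: "\<And>a. a \<in> BA \<Longrightarrow> finite {b. M a b \<noteq> 0}" "\<And>a b. a \<in> BA \<Longrightarrow> M a b \<noteq> 0 \<Longrightarrow> b \<in> BB"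
    and N: "\<And>b. b \<in> BB \<Longrightarrow> finite {a. N b a \<noteq> 0}" "\<And>b a. b \<in> BB \<Longrightarrow> N b a \<noteq> 0 \<Longrightarrow> a \<in> BA"
    and MN: "\<And>a a'. a \<in> BA \<Longrightarrow> (\<Sum>b | M a b \<noteq> 0. M a b * N b a') = (if a' = a then 1 else 0)"
    and NM: "\<And>b b'. b \<in> BB \<Longrightarrow> (\<Sum>a | N b a \<noteq> 0. N b a * M a b') = (if b' = b then 1 else 0)"
    and mult: "\<And>a a' b. a \<in> BA \<Longrightarrow> a' \<in> BA \<Longrightarrow>
      (\<Sum>c | repA (multA a a') c \<noteq> 0. repA (multA a a') c * M c b) =
      (\<Sum>p | M a p \<noteq> 0. \<Sum>q | M a' q \<noteq> 0. M a p * M a' q * repB (multB p q) b)"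
  shows "\<exists>\<psi>. linear_algebra_iso scaleA multA scaleB multB \<psi>"
proof -
  interpret A: based_algebra scaleA multA BA by fact
  interpret B: based_algebra scaleB multB BB by fact
  interpret AB: vector_space_pair scaleA scaleB ..
  obtain \<psi> where \<psi>: "Vector_Spaces.linear scaleA scaleB \<psi>" "\<And>a b. a \<in> BA \<Longrightarrow> B.rep (\<psi> a) b = M a b"
    using A.ex_linear_with_matrix[OF B, of M] M by blast
  obtain \<theta> where \<theta>: "Vector_Spaces.linear scaleB scaleA \<theta>" "\<And>b a. b \<in> BB \<Longrightarrow> A.rep (\<theta> b) a = N b a"
    using B.ex_linear_with_matrix[OF A, of N] N by blast
  have inv1: "\<theta> (\<psi> x) = x" for x
  proof -
    have lin: "Vector_Spaces.linear scaleA scaleA (\<lambda>x. \<theta> (\<psi> x))"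
      using \<psi>(1) \<theta>(1) by (simp add: Vector_Spaces.linear_iff)
    have "A.rep (\<theta> (\<psi> a)) a' = A.rep a a'" if a: "a \<in> BA" for a a'
    proof -
      have "A.rep (\<theta> (\<psi> a)) a' = (\<Sum>b | M a b \<noteq> 0. M a b * A.rep (\<theta> b) a')"
        using B.rep_linear[OF A \<theta>(1), of "\<psi> a" a'] by (simp add: \<psi>(2)[OF a])
      also have "\<dots> = (\<Sum>b | M a b \<noteq> 0. M a b * N b a')"
        using M(2)[OF a] by (intro sum.cong) (auto simp: \<theta>(2))
      finally show ?thesis by (simp add: MN a A.rep_basis)
    qed
    then have "\<theta> (\<psi> a) = id a" if "a \<in> BA" for a
      using that A.rep_eqI[of "\<theta> (\<psi> a)" a] by simp
    then have "\<theta> (\<psi> x) = id x"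
      using vector_space_pair.linear_eq_on[of scaleA scaleA, OF _ lin A.linear_id, of x BA]
        A.spanning vector_space_pair.intro[OF A.vector_space_axioms A.vector_space_axioms] by auto
    then show ?thesis by simp
  qed
  have inv2: "\<psi> (\<theta> y) = y" for y
  proof -
    have lin: "Vector_Spaces.linear scaleB scaleB (\<lambda>x. \<psi> (\<theta> x))"
      using \<psi>(1) \<theta>(1) by (simp add: Vector_Spaces.linear_iff)
    have "B.rep (\<psi> (\<theta> b)) b' = B.rep b b'" if b: "b \<in> BB" for b b'
    proof -
      have "B.rep (\<psi> (\<theta> b)) b' = (\<Sum>a | N b a \<noteq> 0. N b a * B.rep (\<psi> a) b')"
        using A.rep_linear[OF B \<psi>(1), of "\<theta> b" b'] by (simp add: \<theta>(2)[OF b])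
      also have "\<dots> = (\<Sum>a | N b a \<noteq> 0. N b a * M a b')"
        using N(2)[OF b] by (intro sum.cong) (auto simp: \<psi>(2))
      finally show ?thesis by (simp add: NM b B.rep_basis)
    qed
    then have "\<psi> (\<theta> b) = id b" if "b \<in> BB" for b
      using that B.rep_eqI[of "\<psi> (\<theta> b)" b] by simp
    then have "\<psi> (\<theta> y) = id y"
      using vector_space_pair.linear_eq_on[of scaleB scaleB, OF _ lin B.linear_id, of y BB]
        B.spanning vector_space_pair.intro[OF B.vector_space_axioms B.vector_space_axioms] by auto
    then show ?thesis by simp
  qed
  have "bij \<psi>"
    by (rule o_bij[of \<theta>]) (auto simp: inv1 inv2)
  have hom_basis: "\<psi> (multA a a') = multB (\<psi> a) (\<psi> a')" if a: "a \<in> BA" "a' \<in> BA" for a a'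
  proof (rule B.rep_eqI)
    fix b
    have "B.rep (\<psi> (multA a a')) b = (\<Sum>c | A.rep (multA a a') c \<noteq> 0. A.rep (multA a a') c * B.rep (\<psi> c) b)"
      by (rule A.rep_linear[OF B \<psi>(1)])
    also have "\<dots> = (\<Sum>c | A.rep (multA a a') c \<noteq> 0. A.rep (multA a a') c * M c b)"
      using A.representation_ne_zero by (intro sum.cong) (auto simp: \<psi>(2))
    also have "\<dots> = B.rep (multB (\<psi> a) (\<psi> a')) b"
      using mult[OF a, of b] unfolding repA_def repB_def B.rep_mult[of "\<psi> a"] by (simp add: \<psi>(2) a)
    finally show "B.rep (\<psi> (multA a a')) b = B.rep (multB (\<psi> a) (\<psi> a')) b" .
  qed
  have hom_right: "\<psi> (multA a y) = multB (\<psi> a) (\<psi> y)" if a: "a \<in> BA" for a y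
    by (rule AB.linear_eq_on[where B=BA])
       (use \<psi>(1) A.spanning hom_basis[OF a] in
         \<open>auto simp: Vector_Spaces.linear_iff A.mult_simps B.mult_simps\<close>)
  have "\<psi> (multA x y) = multB (\<psi> x) (\<psi> y)" for x y
    by (rule AB.linear_eq_on[where B=BA and f="\<lambda>x. \<psi> (multA x y)" and g="\<lambda>x. multB (\<psi> x) (\<psi> y)"])
       (use \<psi>(1) A.spanning hom_right in
         \<open>auto simp: Vector_Spaces.linear_iff A.mult_simps B.mult_simps\<close>)
  then show ?thesis
    using \<open>bij \<psi>\<close> \<psi>(1) unfolding linear_algebra_iso_def by blast
qed

text \<open>The row of \<open>a\<close> in the matrix of \<open>g\<close> consists of the coordinates of the image of \<open>a \<otimes> 1\<close>.\<close>

lemma lift_coord: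
  fixes \<iota> :: "'k::field \<Rightarrow> 'f::field"
  assumes A: "based_extension scaleA multA BA \<iota>" and B: "based_extension scaleB multB BB \<iota>"
    and g: "lifts_isomorphism scaleA multA scaleB multB \<iota> g"
  shows "based_extension.coord scaleB BB \<iota> b (g x) =
    (\<Sum>a | based_extension.coord scaleA BA \<iota> a x \<noteq> 0.
      based_extension.coord scaleA BA \<iota> a x * based_extension.coord scaleB BB \<iota> b (g (frag_of (a, 1))))"
proof -
  interpret A: based_extension scaleA multA BA \<iota> by fact
  interpret B: based_extension scaleB multB BB \<iota> by fact
  note g = lifts_isomorphismD[OF g]
  show ?thesis
  proof (rule A.functional_expand)
    show "B.coord b (g x) = B.coord b (g y)" if "(x, y) \<in> tensor_cong scaleA \<iota>" for x y
      using that by (intro B.coord_cong) (simp only: g(1))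
    show "B.coord b (g (x + y)) = B.coord b (g x) + B.coord b (g y)" for x y
      using B.coord_cong[OF g(3)] by (simp add: B.coord_add)
    show "B.coord b (g (pre_smult c x)) = c * B.coord b (g x)" for c x
      using B.coord_cong[OF g(4)] by (simp add: B.coord_smult)
  qed (auto intro: A.finite_coord)
qed

lemma lift_matrix_inverse:
  fixes \<iota> :: "'k::field \<Rightarrow> 'f::field"
  assumes A: "based_extension scaleA multA BA \<iota>" and B: "based_extension scaleB multB BB \<iota>"
    and g': "lifts_isomorphism scaleB multB scaleA multA \<iota> g'"
    and inv: "\<And>x. (g' (g x), x) \<in> tensor_cong scaleA \<iota>"
  defines "M \<equiv> \<lambda>a b. based_extension.coord scaleB BB \<iota> b (g (frag_of (a, 1)))"
    and "N \<equiv> \<lambda>b a. based_extension.coord scaleA BA \<iota> a (g' (frag_of (b, 1)))"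
  assumes a: "a \<in> BA"
  shows "(\<Sum>b | M a b \<noteq> 0. M a b * N b a') = (if a' = a then 1 else 0)"
proof -
  interpret A: based_extension scaleA multA BA \<iota> by fact
  have "(\<Sum>b | M a b \<noteq> 0. M a b * N b a') = A.coord a' (g' (g (frag_of (a, 1))))"
    unfolding M_def N_def by (rule lift_coord[OF B A g', symmetric])
  also have "\<dots> = A.coord a' (frag_of (a, 1))" by (rule A.coord_cong[OF inv])
  also have "\<dots> = (if a' = a then 1 else 0)"
    by (simp add: A.rep_basis[OF a] field_embedding_simps(1,5)[OF A.emb])
  finally show ?thesis .
qed

text \<open>Both sides are the coordinate at \<open>b\<close> of the image of \<open>(a \<otimes> 1) (a' \<otimes> 1)\<close>.\<close>

lemma lift_matrix_mult:
  fixes \<iota> :: "'k::field \<Rightarrow> 'f::field"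
  assumes A: "based_extension scaleA multA BA \<iota>" and B: "based_extension scaleB multB BB \<iota>"
    and g: "lifts_isomorphism scaleA multA scaleB multB \<iota> g"
  defines "repA \<equiv> module.representation scaleA BA" and "repB \<equiv> module.representation scaleB BB"
    and "M \<equiv> \<lambda>a b. based_extension.coord scaleB BB \<iota> b (g (frag_of (a, 1)))"
  shows "(\<Sum>c | repA (multA a a') c \<noteq> 0. \<iota> (repA (multA a a') c) * M c b) =
      (\<Sum>p | M a p \<noteq> 0. \<Sum>q | M a' q \<noteq> 0. M a p * M a' q * \<iota> (repB (multB p q) b))"
proof -
  interpret A: based_extension scaleA multA BA \<iota> by fact
  interpret B: based_extension scaleB multB BB \<iota> by fact
  have prod: "pre_mult multA (frag_of (a, 1)) (frag_of (a', 1)) = frag_of (multA a a', 1 :: 'f)"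
    by (simp add: pre_mult_def)
  have "(\<Sum>c | repA (multA a a') c \<noteq> 0. \<iota> (repA (multA a a') c) * M c b)
      = B.coord b (g (frag_of (multA a a', 1)))"
    using lift_coord[OF A B g, of b "frag_of (multA a a', 1)"]
    by (simp add: M_def repA_def field_embedding_simps(6)[OF A.emb])
  also have "\<dots> = B.coord b (pre_mult multB (g (frag_of (a, 1))) (g (frag_of (a', 1))))"
    using B.coord_cong[OF lifts_isomorphismD(5)[OF g, of "frag_of (a, 1)" "frag_of (a', 1)"]]
    by (simp only: prod)
  also have "\<dots> = (\<Sum>p | M a p \<noteq> 0. \<Sum>q | M a' q \<noteq> 0. M a p * M a' q * \<iota> (repB (multB p q) b))"
    unfolding M_def repB_def by (rule B.coord_mult) (auto intro: B.finite_coord)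
  finally show ?thesis .
qed

definition structure_constants where
  "structure_constants scale mul B =
    (\<lambda>((a, a'), c). module.representation scale B (mul a a') c) ` ((B \<times> B) \<times> B)"

text \<open>The matrices \<open>M\<close> and \<open>N\<close> of an isomorphism over \<open>F\<close> and of its inverse solve the equations of
  \<open>linear_algebra_iso_of_matrices\<close> in \<open>F\<close>. Every single equation is a finite sum because the rows have finite
  support, so a homomorphism \<open>h\<close> that fixes the structure constants carries it to \<open>K\<close>. The condition on
  \<open>m\<close> and \<open>n\<close> provides such an \<open>h\<close> for whatever the entries turn out to be.\<close>

lemma descend_isomorphism:
  fixes \<iota> :: "'k::field \<Rightarrow> 'f::field"
    and scaleA :: "'k \<Rightarrow> 'a::ab_group_add \<Rightarrow> 'a" and scaleB :: "'k \<Rightarrow> 'b::ab_group_add \<Rightarrow> 'b"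
  assumes A: "based_extension scaleA multA BA \<iota>" and B: "based_extension scaleB multB BB \<iota>"
    and g: "lifts_isomorphism scaleA multA scaleB multB \<iota> g"
    and specialize: "\<And>m n. \<exists>S (h :: 'f \<Rightarrow> 'k). subring_hom S h \<and>
      \<iota> ` (structure_constants scaleA multA BA \<union> structure_constants scaleB multB BB) \<union>
        (case_prod m ` (BA \<times> BB) \<union> case_prod n ` (BB \<times> BA)) \<subseteq> S \<and>
      (\<forall>c\<in>structure_constants scaleA multA BA \<union> structure_constants scaleB multB BB. h (\<iota> c) = c)"
  shows "\<exists>\<psi>. linear_algebra_iso scaleA multA scaleB multB \<psi>"
proof -
  interpret A: based_extension scaleA multA BA \<iota> by fact
  interpret B: based_extension scaleB multB BB \<iota> by fact
  obtain g' where g': "lifts_isomorphism scaleB multB scaleA multA \<iota> g'"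
    "\<And>x. (g' (g x), x) \<in> tensor_cong scaleA \<iota>" "\<And>z. (g (g' z), z) \<in> tensor_cong scaleB \<iota>"
    using lifts_isomorphism_inverse[OF A.nonassoc_algebra_axioms B.nonassoc_algebra_axioms g] by blast
  define M where "M a b = B.coord b (g (frag_of (a, 1)))" for a b
  define N where "N b a = A.coord a (g' (frag_of (b, 1)))" for b a
  let ?C = "structure_constants scaleA multA BA \<union> structure_constants scaleB multB BB"
  obtain S h where "subring_hom S h" and sub: "\<iota> ` ?C \<subseteq> S" "case_prod M ` (BA \<times> BB) \<subseteq> S"
      "case_prod N ` (BB \<times> BA) \<subseteq> S"
    and hC: "\<And>c. c \<in> ?C \<Longrightarrow> h (\<iota> c) = (c :: 'k)"
    using specialize[of M N] unfolding Un_subset_iff by metis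
  interpret H: subring_hom S h by fact
  have suppM: "b \<in> BB" if "M a b \<noteq> 0" for a b using that B.coord_outside unfolding M_def by blast
  have suppN: "a \<in> BA" if "N b a \<noteq> 0" for a b using that A.coord_outside unfolding N_def by blast
  have finM: "finite {b. M a b \<noteq> 0}" for a unfolding M_def by (rule B.finite_coord)
  have finN: "finite {a. N b a \<noteq> 0}" for b unfolding N_def by (rule A.finite_coord)
  have memM: "M a b \<in> S" if "a \<in> BA" for a b
    using sub(2) that suppM[of a b] H.zero_mem by (cases "M a b = 0") auto
  have memN: "N b a \<in> S" if "b \<in> BB" for a b
    using sub(3) that suppN[of b a] H.zero_mem by (cases "N b a = 0") auto
  have "A.rep (multA a a') c \<in> ?C" if "a \<in> BA" "a' \<in> BA" "c \<in> BA" for a a' c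
    using that unfolding structure_constants_def by force
  then have memA: "\<iota> (A.rep (multA a a') c) \<in> S" "h (\<iota> (A.rep (multA a a') c)) = A.rep (multA a a') c"
    if "a \<in> BA" "a' \<in> BA" "c \<in> BA" for a a' c
    using that sub(1) hC by blast+
  have "B.rep (multB a a') c \<in> ?C" if "a \<in> BB" "a' \<in> BB" "c \<in> BB" for a a' c
    using that unfolding structure_constants_def by force
  then have memB: "\<iota> (B.rep (multB a a') c) \<in> S" "h (\<iota> (B.rep (multB a a') c)) = B.rep (multB a a') c"
    if "a \<in> BB" "a' \<in> BB" "c \<in> BB" for a a' c
    using that sub(1) hC by blast+
  define M' where "M' a b = h (M a b)" for a b
  define N' where "N' b a = h (N b a)" for b a
  \<comment> \<open>Entries may vanish under h, so the supports shrink and the sums are compared over the old ones.\<close>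
  have subM: "{b. M' a b \<noteq> 0} \<subseteq> {b. M a b \<noteq> 0}" for a unfolding M'_def by auto
  have subN: "{a. N' b a \<noteq> 0} \<subseteq> {a. N b a \<noteq> 0}" for b unfolding N'_def by auto
  show ?thesis
  proof (rule linear_algebra_iso_of_matrices[OF A.based_algebra_axioms B.based_algebra_axioms])
    fix a assume a: "a \<in> BA"
    show "finite {b. M' a b \<noteq> 0}" using finite_subset[OF subM finM] .
    show "b \<in> BB" if "M' a b \<noteq> 0" for b using that subM suppM by blast
    show "(\<Sum>b | M' a b \<noteq> 0. M' a b * N' b a') = (if a' = a then 1 else 0)" for a'
    proof -
      have "(\<Sum>b | M' a b \<noteq> 0. M' a b * N' b a') = (\<Sum>b | M a b \<noteq> 0. M' a b * N' b a')"
        using subM finM by (intro sum.mono_neutral_left) auto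
      also have "\<dots> = h (\<Sum>b | M a b \<noteq> 0. M a b * N b a')"
        using a suppM by (subst H.h_sum) (auto simp: M'_def N'_def H.h_mult memM memN H.mult_mem)
      also have "(\<Sum>b | M a b \<noteq> 0. M a b * N b a') = (if a' = a then 1 else 0)"
        unfolding M_def N_def by (rule lift_matrix_inverse[OF A B g'(1,2) a])
      finally show ?thesis by (simp add: H.h_one)
    qed
  next
    fix b assume b: "b \<in> BB"
    show "finite {a. N' b a \<noteq> 0}" using finite_subset[OF subN finN] .
    show "a \<in> BA" if "N' b a \<noteq> 0" for a using that subN suppN by blast
    show "(\<Sum>a | N' b a \<noteq> 0. N' b a * M' a b') = (if b' = b then 1 else 0)" for b'
    proof -
      have "(\<Sum>a | N' b a \<noteq> 0. N' b a * M' a b') = (\<Sum>a | N b a \<noteq> 0. N' b a * M' a b')"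
        using subN finN by (intro sum.mono_neutral_left) auto
      also have "\<dots> = h (\<Sum>a | N b a \<noteq> 0. N b a * M a b')"
        using b suppN by (subst H.h_sum) (auto simp: M'_def N'_def H.h_mult memM memN H.mult_mem)
      also have "(\<Sum>a | N b a \<noteq> 0. N b a * M a b') = (if b' = b then 1 else 0)"
        unfolding M_def N_def by (rule lift_matrix_inverse[OF B A g g'(3) b])
      finally show ?thesis by (simp add: H.h_one)
    qed
  next
    fix a a' b assume a: "a \<in> BA" "a' \<in> BA"
    show "(\<Sum>c | A.rep (multA a a') c \<noteq> 0. A.rep (multA a a') c * M' c b) =
      (\<Sum>p | M' a p \<noteq> 0. \<Sum>q | M' a' q \<noteq> 0. M' a p * M' a' q * B.rep (multB p q) b)"
    proof (cases "b \<in> BB")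
      case False
      then have "B.rep x b = 0" for x using B.representation_ne_zero[of BB x b] by blast
      moreover have "M c b = 0" for c using False suppM by blast
      then have "M' c b = 0" for c by (simp add: M'_def)
      ultimately show ?thesis by simp
    next
      case b: True
      have cB: "c \<in> BA" if "A.rep (multA a a') c \<noteq> 0" for c
        using that A.representation_ne_zero by blast
      have "(\<Sum>c | A.rep (multA a a') c \<noteq> 0. A.rep (multA a a') c * M' c b) =
          h (\<Sum>c | A.rep (multA a a') c \<noteq> 0. \<iota> (A.rep (multA a a') c) * M c b)"
        using cB a by (subst H.h_sum) (auto simp: M'_def H.h_mult memM memA H.mult_mem)
      also have "\<dots> = h (\<Sum>p | M a p \<noteq> 0. \<Sum>q | M a' q \<noteq> 0. M a p * M a' q * \<iota> (B.rep (multB p q) b))"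
        unfolding M_def by (simp only: lift_matrix_mult[OF A B g])
      also have "\<dots> = (\<Sum>p | M a p \<noteq> 0. \<Sum>q | M a' q \<noteq> 0. M' a p * M' a' q * B.rep (multB p q) b)"
      proof -
        have t: "M a p * M a' q * \<iota> (B.rep (multB p q) b) \<in> S"
          "h (M a p * M a' q * \<iota> (B.rep (multB p q) b)) = M' a p * M' a' q * B.rep (multB p q) b"
          if "M a p \<noteq> 0" "M a' q \<noteq> 0" for p q
          using suppM[OF that(1)] suppM[OF that(2)] a b
          by (simp_all add: M'_def H.h_mult memM memB H.mult_mem)
        have "h (\<Sum>q | M a' q \<noteq> 0. M a p * M a' q * \<iota> (B.rep (multB p q) b))
            = (\<Sum>q | M a' q \<noteq> 0. M' a p * M' a' q * B.rep (multB p q) b)" if "M a p \<noteq> 0" for p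
          using that by (subst H.h_sum) (auto simp: t)
        then show ?thesis
          by (subst H.h_sum) (auto simp: t intro!: H.sum_mem)
      qed
      also have "\<dots> = (\<Sum>p | M' a p \<noteq> 0. \<Sum>q | M a' q \<noteq> 0. M' a p * M' a' q * B.rep (multB p q) b)"
        using subM finM by (intro sum.mono_neutral_right) auto
      also have "\<dots> = (\<Sum>p | M' a p \<noteq> 0. \<Sum>q | M' a' q \<noteq> 0. M' a p * M' a' q * B.rep (multB p q) b)"
        using subM finM by (intro sum.cong refl sum.mono_neutral_right) auto
      finally show ?thesis .
    qed
  qed
qed

text \<open>The right-hand side does not mention \<open>F\<close>. A finite-dimensional algebra involves finitely many matrix
  entries, and there the Nullstellensatz applies even to a countable \<open>K\<close>; otherwise the number of entries
  and structure constants is at most \<open>\<omega>\<close>, hence less than \<open>|K|\<close>.\<close>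

lemma scalar_extension_iso_iff:
  fixes \<iota> :: "'k::alg_closed_field \<Rightarrow> 'f::field"
    and scaleA :: "'k \<Rightarrow> 'a::ab_group_add \<Rightarrow> 'a" and scaleB :: "'k \<Rightarrow> 'b::ab_group_add \<Rightarrow> 'b"
    and \<omega> :: "'w rel"
  assumes emb: "field_embedding \<iota>"
    and A: "nonassoc_algebra scaleA multA" and B: "nonassoc_algebra scaleB multB"
    and \<omega>: "Card_order \<omega>"
    and dimA: "vector_space.has_dimension scaleA \<omega>" and dimB: "vector_space.has_dimension scaleB \<omega>"
    and less: "\<omega> <o |UNIV :: 'k set|"
  shows "algebra_isomorphic (scalar_extension scaleA multA \<iota>) (scalar_extension scaleB multB \<iota>) \<longleftrightarrow>
    (\<exists>\<psi>. linear_algebra_iso scaleA multA scaleB multB \<psi>)"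
proof
  assume "\<exists>\<psi>. linear_algebra_iso scaleA multA scaleB multB \<psi>"
  then show "algebra_isomorphic (scalar_extension scaleA multA \<iota>) (scalar_extension scaleB multB \<iota>)"
    unfolding algebra_isomorphic_iff_lifts[OF A B] using lifts_of_linear_algebra_iso by blast
next
  interpret A: nonassoc_algebra scaleA multA by fact
  interpret B: nonassoc_algebra scaleB multB by fact
  assume "algebra_isomorphic (scalar_extension scaleA multA \<iota>) (scalar_extension scaleB multB \<iota>)"
  then obtain g where g: "lifts_isomorphism scaleA multA scaleB multB \<iota> g"
    unfolding algebra_isomorphic_iff_lifts[OF A B] by blast
  obtain BA where BA: "A.independent BA" "A.span BA = UNIV" "|BA| =o \<omega>"
    using dimA unfolding A.has_dimension_def by blast
  obtain BB where BB: "B.independent BB" "B.span BB = UNIV" "|BB| =o \<omega>"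
    using dimB unfolding B.has_dimension_def by blast
  have A': "based_extension scaleA multA BA \<iota>"
    by unfold_locales (use BA emb in auto)
  have B': "based_extension scaleB multB BB \<iota>"
    by unfold_locales (use BB emb in auto)
  show "\<exists>\<psi>. linear_algebra_iso scaleA multA scaleB multB \<psi>"
  proof (rule descend_isomorphism[OF A' B' g])
    fix m :: "'a \<Rightarrow> 'b \<Rightarrow> 'f" and n :: "'b \<Rightarrow> 'a \<Rightarrow> 'f"
    let ?C = "structure_constants scaleA multA BA \<union> structure_constants scaleB multB BB"
    let ?Z = "case_prod m ` (BA \<times> BB) \<union> case_prod n ` (BB \<times> BA)"
    show "\<exists>S (h :: 'f \<Rightarrow> 'k). subring_hom S h \<and> \<iota> ` ?C \<union> ?Z \<subseteq> S \<and> (\<forall>c\<in>?C. h (\<iota> c) = c)"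
    proof (cases "finite (Field \<omega>)")
      case True
      note F = ordIso_symmetric[OF card_of_Field_ordIso[OF \<omega>]]
      have "|BA| =o |Field \<omega>|" "|BB| =o |Field \<omega>|"
        by (rule ordIso_transitive[OF BA(3) F], rule ordIso_transitive[OF BB(3) F])
      then have "finite BA" "finite BB" using True card_of_ordIso_finite by metis+
      then have "finite ?Z" by simp
      from ex_specialization_finite[OF emb this] obtain S where S: "subring S" "range \<iota> \<union> ?Z \<subseteq> S"
        "\<forall>u\<in>S - {0}. \<exists>h. subring_hom S h \<and> (\<forall>c. h (\<iota> c) = (c::'k)) \<and> h u \<noteq> 0"
        by (elim exE conjE)
      from S(3)[rule_format, of 1] subring.one_mem[OF S(1)] obtain h where
        h: "subring_hom S h" "\<forall>c. h (\<iota> c) = (c::'k)" by auto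
      have "\<iota> ` ?C \<union> ?Z \<subseteq> S" using S(2) by blast
      with h show ?thesis by (intro exI[of _ S] exI[of _ h] conjI ballI) simp_all
    next
      case False
      interpret infinite_cardinal \<omega> by unfold_locales (use \<omega> False in auto)
      have le: "|BA| \<le>o \<omega>" "|BB| \<le>o \<omega>" using BA(3) BB(3) by (simp_all add: ordIso_iff_ordLeq)
      have "|?Z| \<le>o \<omega>" by (intro Un_le image_le Times_le le)
      moreover have "|?C| \<le>o \<omega>"
        unfolding structure_constants_def by (intro Un_le image_le Times_le le)
      ultimately show ?thesis by (rule ex_specialization_infinite[OF emb _ _ less])
    qed
  qed
qed

theorem corollary5p3:
  fixes \<iota>\<^sub>1 :: "'k::alg_closed_field \<Rightarrow> 'f1::field"
    and \<iota>\<^sub>2 :: "'k \<Rightarrow> 'f2::field"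
    and scaleA :: "'k \<Rightarrow> 'a::ab_group_add \<Rightarrow> 'a"
    and multA :: "'a \<Rightarrow> 'a \<Rightarrow> 'a"
    and scaleB :: "'k \<Rightarrow> 'b::ab_group_add \<Rightarrow> 'b"
    and multB :: "'b \<Rightarrow> 'b \<Rightarrow> 'b"
    and \<omega> :: "'w rel"
  assumes "field_embedding \<iota>\<^sub>1"
    and "field_embedding \<iota>\<^sub>2"
    and "nonassoc_algebra scaleA multA"
    and "nonassoc_algebra scaleB multB"
    and "Card_order \<omega>"
    and "vector_space.has_dimension scaleA \<omega>"
    and "vector_space.has_dimension scaleB \<omega>"
    and "\<omega> <o |UNIV :: 'k set|"
  shows "algebra_isomorphic (scalar_extension scaleA multA \<iota>\<^sub>1) (scalar_extension scaleB multB \<iota>\<^sub>1)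
     \<longleftrightarrow> algebra_isomorphic (scalar_extension scaleA multA \<iota>\<^sub>2) (scalar_extension scaleB multB \<iota>\<^sub>2)"
  using scalar_extension_iso_iff[OF assms(1) assms(3-8)] scalar_extension_iso_iff[OF assms(2) assms(3-8)]
  by simp

end
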